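(* Let $\Theta\subseteq\mathbb{R}^n$ and $\Xi\subseteq\mathbb{R}^d$ be nonempty and compact, with $\Xi$ convex. Let $\rho$ be a metric on $\Xi$ such that $(\Xi,\rho)$ is a complete, separable, geodesic metric space, let $p\ge1$, and equip $\mathcal P_p(\Xi)$ with the topology induced by the $p$-Wasserstein distance $W_p$ corresponding to $\rho$. Suppose that $\ell:\Theta\times\Xi\to\mathbb{R}$ is jointly continuous. For each $k\in[K]$ let $\varepsilon_k>0$, let $\mathbb B_{\varepsilon_k}(\widehat{\mathbb P}_k)$ be the $p$-Wasserstein ball of radius $\varepsilon_k$ around $\widehat{\mathbb P}_k\in\mathcal P_p(\Xi)$, and let $U\subseteq\mathcal P_p(\Xi)^K$ be the set of all $(\widehat{\mathbb P}_1,\dots,\widehat{\mathbb P}_K)$ for which $\bigcap_{k=1}^K\mathbb B_{\varepsilon_k}(\widehat{\mathbb P}_k)$ has nonempty interior. If for every $(\widehat{\mathbb P}_1,\dots,\widehat{\mathbb P}_K)\in U$ the problem $$\inf_{\theta\in\Theta}\ \sup_{\mathbb Q\in\bigcap_{k=1}^K\mathbb B_{\varepsilon_k}(\widehat{\mathbb P}_k)}\ \int_\Xi\ell(\theta,\xi)\,\mathrm d\mathbb Q(\xi)$$ has a unique minimizer $\theta^\star(\widehat{\mathbb P}_1,\dots,\widehat{\mathbb P}_K)$, then $\theta^\star$ is a continuous function on $U$.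
   Context: $\mathcal P_p(\Xi)$ is the set of Borel probability distributions on $\Xi$ with finite $p$-th moment, $W_p(\mathbb P_1,\mathbb P_2)=\big(\min_{\pi}\int\rho(\xi_1,\xi_2)^p\,\mathrm d\pi\big)^{1/p}$ with the minimum over couplings $\pi$ of $\mathbb P_1,\mathbb P_2$, and $\mathbb B_{\varepsilon}(\widehat{\mathbb P})=\{\mathbb Q\in\mathcal P_p(\Xi): W_p(\mathbb Q,\widehat{\mathbb P})\le\varepsilon\}$. $[K]=\{1,\dots,K\}$. The interior is taken in $(\mathcal P_p(\Xi),W_p)$. *)

theory Defs
  imports "HOL-Probability.Probability"
begin

text \<open>Throughout, a metric space is given by a carrier \<open>M\<close> and a distance \<open>d\<close>, as in the
  locale \<^locale>\<open>Metric_space\<close>.\<close>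

definition metric_borel :: "'a set \<Rightarrow> ('a \<Rightarrow> 'a \<Rightarrow> real) \<Rightarrow> 'a measure" where
  "metric_borel M d = sigma M {S. openin (Metric_space.mtopology M d) S}"

definition geodesic_space :: "'a set \<Rightarrow> ('a \<Rightarrow> 'a \<Rightarrow> real) \<Rightarrow> bool" where
  "geodesic_space M d \<longleftrightarrow>
     (\<forall>x\<in>M. \<forall>y\<in>M. \<exists>\<gamma> :: real \<Rightarrow> 'a.
        \<gamma> ` {0..1} \<subseteq> M \<and> \<gamma> 0 = x \<and> \<gamma> 1 = y \<and>
        (\<forall>s\<in>{0..1}. \<forall>t\<in>{0..1}. d (\<gamma> s) (\<gamma> t) = \<bar>s - t\<bar> * d x y))"

definition wasserstein_space ::
    "'a set \<Rightarrow> ('a \<Rightarrow> 'a \<Rightarrow> real) \<Rightarrow> real \<Rightarrow> 'a measure set" where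
  "wasserstein_space M d p =
     {P. prob_space P \<and> sets P = sets (metric_borel M d) \<and>
         (\<exists>x\<^sub>0\<in>M. (\<integral>\<^sup>+ x. ennreal (d x\<^sub>0 x powr p) \<partial>P) < \<infinity>)}"

definition couplings :: "'a measure \<Rightarrow> 'a measure \<Rightarrow> 'a measure \<Rightarrow> ('a \<times> 'a) measure set" where
  "couplings N P Q =
     {\<pi>. prob_space \<pi> \<and> sets \<pi> = sets (N \<Otimes>\<^sub>M N) \<and> distr \<pi> N fst = P \<and> distr \<pi> N snd = Q}"

text \<open>The infimum below is the minimum whenever \<open>(M, d)\<close> is complete and separable and
  \<open>P\<close>, \<open>Q\<close> lie in \<^const>\<open>wasserstein_space\<close>; it is then also finite, so that
  \<^const>\<open>enn2real\<close> loses nothing.\<close>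

definition wasserstein ::
    "'a set \<Rightarrow> ('a \<Rightarrow> 'a \<Rightarrow> real) \<Rightarrow> real \<Rightarrow> 'a measure \<Rightarrow> 'a measure \<Rightarrow> real" where
  "wasserstein M d p P Q =
     enn2real (INF \<pi>\<in>couplings (metric_borel M d) P Q.
                 \<integral>\<^sup>+ z. ennreal (d (fst z) (snd z) powr p) \<partial>\<pi>) powr (1 / p)"

definition wasserstein_topology ::
    "'a set \<Rightarrow> ('a \<Rightarrow> 'a \<Rightarrow> real) \<Rightarrow> real \<Rightarrow> 'a measure topology" where
  "wasserstein_topology M d p =
     Metric_space.mtopology (wasserstein_space M d p) (wasserstein M d p)"

definition wasserstein_ball ::
    "'a set \<Rightarrow> ('a \<Rightarrow> 'a \<Rightarrow> real) \<Rightarrow> real \<Rightarrow> 'a measure \<Rightarrow> real \<Rightarrow> 'a measure set" where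
  "wasserstein_ball M d p P \<epsilon> = {Q \<in> wasserstein_space M d p. wasserstein M d p Q P \<le> \<epsilon>}"

definition ball_intersection ::
    "'a set \<Rightarrow> ('a \<Rightarrow> 'a \<Rightarrow> real) \<Rightarrow> real \<Rightarrow> nat \<Rightarrow> (nat \<Rightarrow> real) \<Rightarrow> (nat \<Rightarrow> 'a measure) \<Rightarrow> 'a measure set"
  where
  "ball_intersection M d p K \<epsilon> P = (\<Inter>k\<in>{1..K}. wasserstein_ball M d p (P k) (\<epsilon> k))"

definition interior_centers ::
    "'a set \<Rightarrow> ('a \<Rightarrow> 'a \<Rightarrow> real) \<Rightarrow> real \<Rightarrow> nat \<Rightarrow> (nat \<Rightarrow> real) \<Rightarrow> (nat \<Rightarrow> 'a measure) set" where
  "interior_centers M d p K \<epsilon> =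
     {P \<in> {1..K} \<rightarrow>\<^sub>E wasserstein_space M d p.
        wasserstein_topology M d p interior_of ball_intersection M d p K \<epsilon> P \<noteq> {}}"

definition worst_case_risk ::
    "'a measure set \<Rightarrow> ('t \<Rightarrow> 'a \<Rightarrow> real) \<Rightarrow> 't \<Rightarrow> ereal" where
  "worst_case_risk \<Q> l \<theta> = (SUP Q\<in>\<Q>. ereal (\<integral>\<xi>. l \<theta> \<xi> \<partial>Q))"

end

theory Submission
  imports Defs
begin

text \<open>
  \<open>W\<^sub>p\<^sup>p\<close> is convex under mixing: \<open>W\<^sub>p\<^sup>p((1 - t)P + tQ, R) \<le> (1 - t) W\<^sub>p\<^sup>p(P, R) + t W\<^sub>p\<^sup>p(Q, R)\<close>.
  Hence an interior point of the intersection of the balls can be moved, by mixing in a little of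
  each centre successively, to a point \<open>Q\<^sub>0\<close> lying strictly inside every ball. Mixing an arbitrary
  \<open>Q\<close> of the intersection with a small proportion of \<open>Q\<^sub>0\<close> pulls \<open>Q\<close> inside by a uniform amount, while
  changing \<open>\<integral> l \<theta> dQ\<close> only by a small multiple of the bound of \<open>l\<close>. So the worst-case risk depends
  continuously on the centres, uniformly in \<open>\<theta>\<close>, and a unique minimiser over a compact set cannot jump.
\<close>

section \<open>Borel structure of a separable metric space\<close>

text \<open>Balls and open sets can be handled only once \<open>W\<close> is known to be a metric,
  and this has to be shown for real \<open>p\<close> and any separable \<open>\<rho>\<close>. Two
  classical ingredients are replaced: optimal couplings by couplings within a prescribed slack of
  the infimum, and Minkowski's inequality by pointwise convexity of the p-th power with weights
  tuned to the two distances. Since convexity under mixing is a statement about p-th powers, the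
  uniform amount by which mixing pulls a measure inside is first obtained between powers and then
  carried back to distances by continuity of \<open>powr\<close>. A second obstacle is that
  \<open>\<rho>\<close> need not induce the Euclidean topology in which \<open>l\<close> is
  continuous, so \<open>l \<theta>\<close> may fail to be Borel for \<open>\<rho>\<close>. Several
  estimates therefore treat the default value 0 of the Bochner integral as a separate case.
  Compactness of \<open>\<Xi>\<close> enters through the bound on \<open>l\<close> and its uniform
  continuity.\<close>

lemma space_metric_borel: "Metric_space M d \<Longrightarrow> space (metric_borel M d) = M"
  unfolding metric_borel_def by (rule space_measure_of) (auto dest!: openin_subset simp: Metric_space.topspace_mtopology)

lemma openin_in_sets_metric_borel:
  assumes "Metric_space M d" "openin (Metric_space.mtopology M d) U"
  shows "U \<in> sets (metric_borel M d)"
proof -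
  have "{S. openin (Metric_space.mtopology M d) S} \<subseteq> Pow M"
    using assms by (auto dest!: openin_subset simp: Metric_space.topspace_mtopology)
  then show ?thesis
    using assms unfolding metric_borel_def by (simp add: sigma_sets.Basic)
qed

locale wasserstein_metric = Metric_space M d
  for M :: "'a set" and d :: "'a \<Rightarrow> 'a \<Rightarrow> real" +
  fixes p :: real
  assumes separable: "separable_space mtopology" and p_ge_1: "p \<ge> 1"
begin

abbreviation "N \<equiv> metric_borel M d"
abbreviation "\<W> \<equiv> wasserstein_space M d p"
abbreviation "W \<equiv> wasserstein M d p"

lemma space_N [simp]: "space N = M"
  by (rule space_metric_borel) unfold_locales

lemma open_in_sets: "openin mtopology U \<Longrightarrow> U \<in> sets N"
  by (rule openin_in_sets_metric_borel) unfold_locales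

lemma countable_dense:
  obtains C where "countable C" "C \<subseteq> M" "\<And>x e. x \<in> M \<Longrightarrow> e > 0 \<Longrightarrow> \<exists>c\<in>C. d x c < e"
proof -
  obtain C where C: "countable C" "C \<subseteq> M" "mtopology closure_of C = M"
    using separable unfolding separable_space_def by auto
  have "\<exists>c\<in>C. d x c < e" if "x \<in> M" "e > 0" for x e
  proof -
    have "x \<in> mtopology closure_of C" using C that by simp
    then show ?thesis using that unfolding metric_closure_of by (auto simp: in_mball)
  qed
  with C show thesis using that by blast
qed

lemma measurable_dist_left [measurable]:
  assumes "x \<in> M" shows "d x \<in> borel_measurable N"
proof (rule borel_measurableI_less)
  fix r
  have "{y \<in> space N. d x y < r} = mball x r"
    using assms by (auto simp: in_mball)
  then show "{y \<in> space N. d x y < r} \<in> sets N"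
    by (simp add: open_in_sets openin_mball)
qed

text \<open>In general the product sigma-algebra may be smaller than the Borel sets of the product,
  so continuity of \<open>d\<close> alone is not enough. Separability helps: \<open>d x y\<close> is
  the infimum of \<open>d c x + d c y\<close> over a countable dense set, and each term is a sum of
  functions of one coordinate.\<close>

lemma measurable_dist [measurable]: "(\<lambda>z. d (fst z) (snd z)) \<in> borel_measurable (N \<Otimes>\<^sub>M N)"
proof (cases "M = {}")
  case True
  then have "space (N \<Otimes>\<^sub>M N) = {}" by (metis Sigma_empty1 space_N space_pair_measure)
  then show ?thesis by (intro borel_measurableI_less) auto
next
  case False
  obtain C where C: "countable C" "C \<subseteq> M" "\<And>x e. x \<in> M \<Longrightarrow> e > 0 \<Longrightarrow> \<exists>c\<in>C. d x c < e"
    by (rule countable_dense) blast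
  have C_ne: "C \<noteq> {}" using False C(3)[of _ 1] by auto
  have eq: "d x y = (INF c\<in>C. d c x + d c y)" if x: "x \<in> M" and y: "y \<in> M" for x y
  proof (rule antisym)
    have bdd: "bdd_below ((\<lambda>c. d c x + d c y) ` C)"
      by (rule bdd_belowI2[of _ 0]) simp
    show "d x y \<le> (INF c\<in>C. d c x + d c y)"
      using C_ne x y C(2) by (intro cINF_greatest) (metis commute triangle subsetD)+
    show "(INF c\<in>C. d c x + d c y) \<le> d x y"
    proof (rule field_le_epsilon)
      fix e :: real assume "e > 0"
      then obtain c where c: "c \<in> C" "d x c < e / 2" using C(3)[of x "e/2"] x by auto
      have "(INF c\<in>C. d c x + d c y) \<le> d c x + d c y" by (rule cINF_lower[OF bdd c(1)])
      also have "d c y \<le> d c x + d x y" using c C(2) x y by (intro triangle) auto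
      finally show "(INF c\<in>C. d c x + d c y) \<le> d x y + e" using c(2) commute[of x c] by simp
    qed
  qed
  have "(\<lambda>z. INF c\<in>C. d c (fst z) + d c (snd z)) \<in> borel_measurable (N \<Otimes>\<^sub>M N)"
  proof (rule borel_measurable_cINF[OF C(1)])
    fix c assume "c \<in> C"
    then have [measurable]: "d c \<in> borel_measurable N" using C by auto
    show "(\<lambda>z. d c (fst z) + d c (snd z)) \<in> borel_measurable (N \<Otimes>\<^sub>M N)" by measurable
  next
    fix z show "bdd_below ((\<lambda>c. d c (fst z) + d c (snd z)) ` C)"
      by (rule bdd_belowI2[of _ 0]) simp
  qed
  then show ?thesis
    by (rule measurable_cong[THEN iffD1, rotated]) (auto simp: space_pair_measure eq)
qed

lemma wasserstein_spaceD:
  assumes "P \<in> \<W>"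
  shows "prob_space P" "sets P = sets N" "space P = M"
proof -
  show "prob_space P" "sets P = sets N" using assms by (auto simp: wasserstein_space_def)
  then show "space P = M" by (metis sets_eq_imp_space_eq space_N)
qed

text \<open>Provides the cells for the gluing below: a point is labelled with the first member of a
  dense sequence within \<open>e / 2\<close> of it, so points with equal labels are close by the
  triangle inequality.\<close>

lemma fine_partition:
  assumes "e > 0"
  obtains i :: "'a \<Rightarrow> nat"
    where "i \<in> measurable N (count_space UNIV)"
      "\<And>x y. x \<in> M \<Longrightarrow> y \<in> M \<Longrightarrow> i x = i y \<Longrightarrow> d x y < e"
proof (cases "M = {}")
  case True
  then show ?thesis using that[of "\<lambda>_. 0"] by auto
next
  case False
  obtain C where C: "countable C" "C \<subseteq> M" "\<And>x e. x \<in> M \<Longrightarrow> e > 0 \<Longrightarrow> \<exists>c\<in>C. d x c < e"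
    by (rule countable_dense) blast
  have C_ne: "C \<noteq> {}" using False C(3)[of _ 1] by auto
  define c where "c = from_nat_into C"
  have c: "c n \<in> M" for n using C(2) from_nat_into[OF C_ne] by (auto simp: c_def)
  then have [measurable]: "d (c n) \<in> borel_measurable N" for n by auto
  define i where "i x = (LEAST n. d (c n) x < e / 2)" for x
  have "i \<in> measurable N (count_space UNIV)" unfolding i_def by measurable
  moreover have c_i: "d (c (i x)) x < e / 2" if x: "x \<in> M" for x
  proof -
    obtain a where a: "a \<in> C" "d x a < e / 2" using C(3)[of x "e/2"] x assms by auto
    obtain n where "a = c n" unfolding c_def using from_nat_into_surj[OF C(1) a(1)] by auto
    then have "d (c n) x < e / 2" using a by (simp add: commute)
    then show ?thesis unfolding i_def by (rule LeastI)
  qed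
  have "d x y < e" if "x \<in> M" "y \<in> M" "i x = i y" for x y
    using triangle[OF that(1) c[of "i x"] that(2)] commute[of x "c (i x)"]
      c_i[OF that(1)] c_i[OF that(2)] that(3) by simp
  ultimately show ?thesis using that by blast
qed

end

section \<open>Couplings and gluing\<close>

text \<open>Convexity of the p-th power at \<open>x / a\<close> and \<open>y / b\<close> with
  weights \<open>a / (a + b)\<close> and \<open>b / (a + b)\<close>. If the integrals of
  \<open>x powr p\<close> and \<open>y powr p\<close> are at most \<open>a powr p\<close> and
  \<open>b powr p\<close>, integrating this bound gives \<open>(a + b) powr p\<close>, which is how
  it replaces Minkowski's inequality.\<close>

lemma powr_add_le_weighted:
  fixes x y a b p :: real
  assumes "p \<ge> 1" "x \<ge> 0" "y \<ge> 0" "a > 0" "b > 0"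
  shows "(x + y) powr p \<le> (a + b) powr (p - 1) * (x powr p / a powr (p - 1) + y powr p / b powr (p - 1))"
proof -
  have mono: "a powr (p - 1) \<le> (a + b) powr (p - 1)" "b powr (p - 1) \<le> (a + b) powr (p - 1)"
    using assms by (auto intro!: powr_mono2)
  consider "x = 0" | "y = 0" | "x > 0" "y > 0" using assms by linarith
  then show ?thesis
  proof cases
    case 1
    then show ?thesis using mono assms by (simp add: field_simps mult_left_mono)
  next
    case 2
    then show ?thesis using mono assms by (simp add: field_simps mult_left_mono)
  next
    case 3
    define t where "t = b / (a + b)"
    have t: "0 \<le> t" "t \<le> 1" "1 - t = a / (a + b)" using assms by (auto simp: t_def field_simps)
    have "((1 - t) * (x / a) + t * (y / b)) powr p \<le> (1 - t) * (x / a) powr p + t * (y / b) powr p"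
      using convex_onD[OF powr_convex[OF assms(1)] t(1,2), of "x / a" "y / b"] 3 assms by simp
    moreover have "(1 - t) * (x / a) + t * (y / b) = (x + y) / (a + b)"
      using assms unfolding t(3) by (simp add: t_def add_divide_distrib)
    ultimately have "(x + y) powr p / (a + b) powr p
        \<le> a / (a + b) * (x powr p / a powr p) + b / (a + b) * (y powr p / b powr p)"
      using assms 3 unfolding t(3) by (simp add: t_def powr_divide)
    then have "(x + y) powr p
        \<le> (a + b) powr p * (a / (a + b) * (x powr p / a powr p) + b / (a + b) * (y powr p / b powr p))"
      using assms by (simp add: pos_divide_le_eq mult.commute)
    also have "\<dots> = (a + b) powr (p - 1) * (x powr p / a powr (p - 1) + y powr p / b powr (p - 1))"
      using assms by (simp add: powr_diff divide_simps)
    finally show ?thesis .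
  qed
qed

lemma couplingsD:
  assumes "\<pi> \<in> couplings N P Q"
  shows "prob_space \<pi>" "sets \<pi> = sets (N \<Otimes>\<^sub>M N)" "space \<pi> = space N \<times> space N"
    "distr \<pi> N fst = P" "distr \<pi> N snd = Q"
proof -
  show *: "prob_space \<pi>" "sets \<pi> = sets (N \<Otimes>\<^sub>M N)" "distr \<pi> N fst = P" "distr \<pi> N snd = Q"
    using assms by (auto simp: couplings_def)
  show "space \<pi> = space N \<times> space N"
    using sets_eq_imp_space_eq[OF *(2)] by (simp add: space_pair_measure)
qed

lemma couplings_measurable:
  assumes "\<pi> \<in> couplings N P Q"
  shows "measurable \<pi> L = measurable (N \<Otimes>\<^sub>M N) L"
  using couplingsD(2)[OF assms] by (rule measurable_cong_sets) simp

lemma couplings_marginals: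
  assumes "\<pi> \<in> couplings N P Q" and [measurable]: "f \<in> borel_measurable N"
  shows "(\<integral>\<^sup>+ z. f (fst z) \<partial>\<pi>) = (\<integral>\<^sup>+ x. f x \<partial>P)"
    and "(\<integral>\<^sup>+ z. f (snd z) \<partial>\<pi>) = (\<integral>\<^sup>+ x. f x \<partial>Q)"
  using couplings_measurable[OF assms(1), of N]
  by (auto simp: nn_integral_distr simp flip: couplingsD(4,5)[OF assms(1)])

lemma distr_snd_fst_swap:
  assumes "\<pi> \<in> couplings N P Q"
  shows "distr \<pi> (N \<Otimes>\<^sub>M N) (\<lambda>z. (snd z, fst z)) \<in> couplings N Q P"
proof -
  interpret prob_space \<pi> using couplingsD[OF assms] by simp
  note m = couplings_measurable[OF assms]
  have [measurable]: "(\<lambda>z. (snd z, fst z)) \<in> measurable \<pi> (N \<Otimes>\<^sub>M N)"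
    unfolding m by measurable
  show ?thesis
    using couplingsD(4,5)[OF assms]
    by (auto simp: couplings_def distr_distr comp_def intro!: prob_space_distr)
qed

text \<open>There are only countably many labels, so the null cells together form a null set. This
  keeps the divisor in the gluing density nonzero almost everywhere.\<close>

lemma (in prob_space) AE_fibre_pos:
  fixes i :: "'a \<Rightarrow> nat"
  assumes [measurable]: "i \<in> measurable M (count_space UNIV)"
  shows "AE y in M. emeasure M (i -` {i y} \<inter> space M) \<noteq> 0"
proof -
  have "AE y in M. \<forall>n. i y = n \<longrightarrow> emeasure M (i -` {n} \<inter> space M) \<noteq> 0"
    unfolding AE_all_countable
  proof
    fix n
    show "AE y in M. i y = n \<longrightarrow> emeasure M (i -` {n} \<inter> space M) \<noteq> 0"
    proof (cases "emeasure M (i -` {n} \<inter> space M) = 0")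
      case True
      then have "i -` {n} \<inter> space M \<in> null_sets M" by (auto intro!: null_setsI)
      then show ?thesis by (rule AE_I') auto
    qed auto
  qed
  then show ?thesis by auto
qed

text \<open>Gluing along a countable partition of the middle space: conditionally on the cell of the
  middle coordinate, the two couplings are taken independently. This avoids disintegration, at the
  price of the two middle coordinates agreeing only up to the diameter of the cells.\<close>

lemma couplings_glue:
  fixes i :: "'a \<Rightarrow> nat"
  assumes \<pi>: "\<pi> \<in> couplings N P Q" and \<sigma>: "\<sigma> \<in> couplings N Q R"
    and i [measurable]: "i \<in> measurable N (count_space UNIV)"
  obtains \<Gamma> where "sets \<Gamma> = sets ((N \<Otimes>\<^sub>M N) \<Otimes>\<^sub>M (N \<Otimes>\<^sub>M N))"
    "\<And>f. f \<in> borel_measurable (N \<Otimes>\<^sub>M N) \<Longrightarrow> (\<integral>\<^sup>+ z. f (fst z) \<partial>\<Gamma>) = (\<integral>\<^sup>+ z. f z \<partial>\<pi>)"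
    "\<And>f. f \<in> borel_measurable (N \<Otimes>\<^sub>M N) \<Longrightarrow> (\<integral>\<^sup>+ z. f (snd z) \<partial>\<Gamma>) = (\<integral>\<^sup>+ z. f z \<partial>\<sigma>)"
    "AE z in \<Gamma>. i (snd (fst z)) = i (fst (snd z))"
proof -
  interpret \<pi>: prob_space \<pi> using couplingsD[OF \<pi>] by simp
  interpret \<sigma>: prob_space \<sigma> using couplingsD[OF \<sigma>] by simp
  interpret pair_sigma_finite \<pi> \<sigma> ..
  note [measurable_cong] = couplingsD(2)[OF \<pi>] couplingsD(2)[OF \<sigma>]
  have sQ: "sets Q = sets N" using couplingsD(5)[OF \<pi>] by auto
  then have spQ: "space Q = space N" by (rule sets_eq_imp_space_eq)
  interpret Q: prob_space Q
    unfolding couplingsD(5)[OF \<pi>, symmetric] by (rule \<pi>.prob_space_distr) measurable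
  define w where "w n = emeasure Q (i -` {n} \<inter> space Q)" for n
  \<comment> \<open>A density with respect to the product: pairs with different labels are
    discarded, and dividing by the mass of the cell restores both marginals.\<close>
  define g :: "('a \<times> 'a) \<times> ('a \<times> 'a) \<Rightarrow> ennreal" where
    "g z = (if i (snd (fst z)) = i (fst (snd z)) then 1 / w (i (snd (fst z))) else 0)" for z
  define \<Gamma> where "\<Gamma> = density (\<pi> \<Otimes>\<^sub>M \<sigma>) g"
  have iQ [measurable]: "i \<in> measurable Q (count_space UNIV)"
    using i sQ measurable_cong_sets by blast
  have [measurable]: "(\<lambda>x. 1 / w (i x)) \<in> borel_measurable N"
    by (rule measurable_compose[OF i]) simp
  have g [measurable]: "g \<in> borel_measurable (\<pi> \<Otimes>\<^sub>M \<sigma>)" 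
    unfolding g_def
  proof (rule measurable_If)
    show "(\<lambda>z. 1 / w (i (snd (fst z)))) \<in> borel_measurable (\<pi> \<Otimes>\<^sub>M \<sigma>)"
      by (rule measurable_compose[of _ _ N "\<lambda>x. 1 / w (i x)"]) measurable
    have "Measurable.pred (\<pi> \<Otimes>\<^sub>M \<sigma>) (\<lambda>z. \<exists>n. i (fst (snd z)) = n \<and> i (snd (fst z)) = n)"
      by measurable
    then show "{z \<in> space (\<pi> \<Otimes>\<^sub>M \<sigma>). i (snd (fst z)) = i (fst (snd z))} \<in> sets (\<pi> \<Otimes>\<^sub>M \<sigma>)"
      by (simp add: pred_def)
  qed simp
  have w_pos: "AE y in Q. w (i y) \<noteq> 0" unfolding w_def by (rule Q.AE_fibre_pos[OF iQ])
  have w_fin: "w n \<noteq> \<infinity>" for n unfolding w_def by (simp add: Q.emeasure_eq_measure)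
  \<comment> \<open>On a cell of mass 0 the factor \<open>1 / w n\<close> is infinite and its
    product with \<open>w n\<close> is 0, not 1. The two marginal computations below discard such
    cells as null.\<close>
  have fibre: "(\<integral>\<^sup>+ y. (if n = i y then 1 / w n else 0) \<partial>Q) = (if w n = 0 then 0 else 1)" for n
  proof -
    have "(\<integral>\<^sup>+ y. (if n = i y then 1 / w n else 0) \<partial>Q)
        = (\<integral>\<^sup>+ y. 1 / w n * indicator (i -` {n} \<inter> space Q) y \<partial>Q)"
      by (rule nn_integral_cong) (auto simp: indicator_def)
    also have "\<dots> = 1 / w n * w n"
      unfolding w_def by (rule nn_integral_cmult_indicator) measurable
    finally show ?thesis using w_fin[of n] by (auto simp: ennreal_divide_times ennreal_divide_self less_top)
  qed
  show thesis
  proof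
    show "sets \<Gamma> = sets ((N \<Otimes>\<^sub>M N) \<Otimes>\<^sub>M (N \<Otimes>\<^sub>M N))"
      unfolding \<Gamma>_def using couplingsD(2)[OF \<pi>] couplingsD(2)[OF \<sigma>]
      by (simp cong: sets_pair_measure_cong)
  next
    fix f :: "'a \<times> 'a \<Rightarrow> ennreal" assume f [measurable]: "f \<in> borel_measurable (N \<Otimes>\<^sub>M N)"
    have "(\<integral>\<^sup>+ z. f (fst z) \<partial>\<Gamma>) = (\<integral>\<^sup>+ z. g z * f (fst z) \<partial>(\<pi> \<Otimes>\<^sub>M \<sigma>))"
      unfolding \<Gamma>_def by (rule nn_integral_density) measurable
    also have "\<dots> = (\<integral>\<^sup>+ z1. \<integral>\<^sup>+ z2. g (z1, z2) * f (fst (z1, z2)) \<partial>\<sigma> \<partial>\<pi>)"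
      by (rule \<sigma>.nn_integral_fst[symmetric]) measurable
    also have "\<dots> = (\<integral>\<^sup>+ z1. f z1 * (if w (i (snd z1)) = 0 then 0 else 1) \<partial>\<pi>)"
    proof (rule nn_integral_cong)
      fix z1 assume z1: "z1 \<in> space \<pi>"
      let ?n = "i (snd z1)"
      have "(\<integral>\<^sup>+ z2. g (z1, z2) * f (fst (z1, z2)) \<partial>\<sigma>)
          = (\<integral>\<^sup>+ z2. (\<lambda>y. f z1 * (if ?n = i y then 1 / w ?n else 0)) (fst z2) \<partial>\<sigma>)"
        by (rule nn_integral_cong) (auto simp add: g_def mult.commute)
      also have "\<dots> = (\<integral>\<^sup>+ y. f z1 * (if ?n = i y then 1 / w ?n else 0) \<partial>Q)"
        by (rule couplings_marginals(1)[OF \<sigma>]) measurable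
      also have "\<dots> = f z1 * (\<integral>\<^sup>+ y. (if ?n = i y then 1 / w ?n else 0) \<partial>Q)"
        by (rule nn_integral_cmult) measurable
      finally show "(\<integral>\<^sup>+ z2. g (z1, z2) * f (fst (z1, z2)) \<partial>\<sigma>) = f z1 * (if w ?n = 0 then 0 else 1)"
        unfolding fibre .
    qed
    also have "\<dots> = (\<integral>\<^sup>+ z1. f z1 \<partial>\<pi>)"
    proof (rule nn_integral_cong_AE)
      have "AE z in \<pi>. w (i (snd z)) \<noteq> 0"
        using w_pos unfolding couplingsD(5)[OF \<pi>, symmetric] 
        by (subst (asm) AE_distr_iff) auto
      then show "AE z1 in \<pi>. f z1 * (if w (i (snd z1)) = 0 then 0 else 1) = f z1" by eventually_elim simp
    qed
    finally show "(\<integral>\<^sup>+ z. f (fst z) \<partial>\<Gamma>) = (\<integral>\<^sup>+ z. f z \<partial>\<pi>)" .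
  next
    fix f :: "'a \<times> 'a \<Rightarrow> ennreal" assume f [measurable]: "f \<in> borel_measurable (N \<Otimes>\<^sub>M N)"
    have "(\<integral>\<^sup>+ z. f (snd z) \<partial>\<Gamma>) = (\<integral>\<^sup>+ z. g z * f (snd z) \<partial>(\<pi> \<Otimes>\<^sub>M \<sigma>))"
      unfolding \<Gamma>_def by (rule nn_integral_density) measurable
    also have "\<dots> = (\<integral>\<^sup>+ z2. \<integral>\<^sup>+ z1. g (z1, z2) * f (snd (z1, z2)) \<partial>\<pi> \<partial>\<sigma>)"
      by (rule nn_integral_snd[symmetric]) measurable
    also have "\<dots> = (\<integral>\<^sup>+ z2. f z2 * (if w (i (fst z2)) = 0 then 0 else 1) \<partial>\<sigma>)"
    proof (rule nn_integral_cong)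
      fix z2 assume z2: "z2 \<in> space \<sigma>"
      let ?n = "i (fst z2)"
      have "(\<integral>\<^sup>+ z1. g (z1, z2) * f (snd (z1, z2)) \<partial>\<pi>)
          = (\<integral>\<^sup>+ z1. (\<lambda>y. f z2 * (if ?n = i y then 1 / w ?n else 0)) (snd z1) \<partial>\<pi>)"
        by (rule nn_integral_cong) (auto simp add: g_def mult.commute)
      also have "\<dots> = (\<integral>\<^sup>+ y. f z2 * (if ?n = i y then 1 / w ?n else 0) \<partial>Q)"
        by (rule couplings_marginals(2)[OF \<pi>]) measurable
      also have "\<dots> = f z2 * (\<integral>\<^sup>+ y. (if ?n = i y then 1 / w ?n else 0) \<partial>Q)"
        by (rule nn_integral_cmult) measurable
      finally show "(\<integral>\<^sup>+ z1. g (z1, z2) * f (snd (z1, z2)) \<partial>\<pi>) = f z2 * (if w ?n = 0 then 0 else 1)"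
        unfolding fibre .
    qed
    also have "\<dots> = (\<integral>\<^sup>+ z2. f z2 \<partial>\<sigma>)"
    proof (rule nn_integral_cong_AE)
      have "AE z in \<sigma>. w (i (fst z)) \<noteq> 0"
        using w_pos unfolding couplingsD(4)[OF \<sigma>, symmetric] 
        by (subst (asm) AE_distr_iff) auto
      then show "AE z2 in \<sigma>. f z2 * (if w (i (fst z2)) = 0 then 0 else 1) = f z2" by eventually_elim simp
    qed
    finally show "(\<integral>\<^sup>+ z. f (snd z) \<partial>\<Gamma>) = (\<integral>\<^sup>+ z. f z \<partial>\<sigma>)" .
  next
    show "AE z in \<Gamma>. i (snd (fst z)) = i (fst (snd z))"
      unfolding \<Gamma>_def by (subst AE_density) (auto simp: g_def)
  qed
qed

section \<open>Mixtures and the triangle inequality\<close>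

text \<open>Encoded with \<open>bind\<close>, so that total mass, images and integrals follow from
  the rules of the probability monad. \<open>bernoulli_pmf\<close> clamps its parameter, so mixing
  probability measures gives a probability measure for every real \<open>t\<close>; the range of
  \<open>t\<close> matters for the weights in the integral formulas.\<close>

definition mix :: "real \<Rightarrow> 'b measure \<Rightarrow> 'b measure \<Rightarrow> 'b measure" where
  "mix t P Q = measure_pmf (bernoulli_pmf t) \<bind> (\<lambda>b. if b then Q else P)"

context
  fixes P Q N :: "'b measure" and t :: real
  assumes P: "prob_space P" "sets P = sets N" and Q: "prob_space Q" "sets Q = sets N"
begin

lemma mix_kernel: "(\<lambda>b. if b then Q else P) \<in> measurable (measure_pmf (bernoulli_pmf t)) (subprob_algebra N)"
  using P Q by (auto simp: space_subprob_algebra prob_space_imp_subprob_space)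

lemma sets_mix: "sets (mix t P Q) = sets N"
  unfolding mix_def by (rule sets_bind_measurable[OF mix_kernel]) simp

lemma prob_space_mix: "prob_space (mix t P Q)"
  unfolding mix_def using P Q
  by (intro measure_pmf.prob_space_bind[OF _ mix_kernel]) auto

lemma distr_mix: "f \<in> measurable N L \<Longrightarrow> distr (mix t P Q) L f = mix t (distr P L f) (distr Q L f)"
  unfolding mix_def by (subst distr_bind[OF mix_kernel]) (auto intro!: arg_cong2[where f=bind])

lemma nn_integral_mix:
  assumes "f \<in> borel_measurable N" "0 \<le> t" "t \<le> 1"
  shows "(\<integral>\<^sup>+ x. f x \<partial>mix t P Q) = ennreal (1 - t) * (\<integral>\<^sup>+ x. f x \<partial>P) + ennreal t * (\<integral>\<^sup>+ x. f x \<partial>Q)"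
  unfolding mix_def using assms(2,3)
  by (subst nn_integral_bind[OF assms(1) mix_kernel]) (auto simp: nn_integral_bernoulli_pmf algebra_simps)

lemma integral_mix:
  fixes f :: "'b \<Rightarrow> real"
  assumes "f \<in> borel_measurable N" "\<And>x. x \<in> space N \<Longrightarrow> \<bar>f x\<bar> \<le> B" "0 \<le> t" "t \<le> 1"
  shows "(\<integral> x. f x \<partial>mix t P Q) = (1 - t) * (\<integral> x. f x \<partial>P) + t * (\<integral> x. f x \<partial>Q)"
proof -
  have "emeasure P (space P) \<le> ennreal 1" "emeasure Q (space Q) \<le> ennreal 1"
    using P Q by (auto simp: prob_space.emeasure_space_1)
  then have "(\<integral> x. f x \<partial>mix t P Q) = (\<integral> b. (\<integral> x. f x \<partial>(if b then Q else P)) \<partial>measure_pmf (bernoulli_pmf t))"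
    unfolding mix_def
    by (intro integral_bind[OF assms(1,2) mix_kernel, where B'=1]) (auto simp: measure_pmf.finite_measure_axioms)
  then show ?thesis using assms(3,4) by (simp add: algebra_simps)
qed

end

text \<open>Used when two couplings with the same second marginal are mixed: that marginal is
  unchanged.\<close>

lemma mix_same: 
  assumes "prob_space P" "0 \<le> t" "t \<le> 1" shows "mix t P P = P"
proof (rule measure_eqI)
  show s: "sets (mix t P P) = sets P" using assms by (intro sets_mix) auto
  fix A assume A: "A \<in> sets (mix t P P)"
  then have A': "A \<in> sets P" using s by simp
  have "emeasure (mix t P P) A = (\<integral>\<^sup>+ x. indicator A x \<partial>mix t P P)" using A by simp
  also have "\<dots> = ennreal (1 - t) * emeasure P A + ennreal t * emeasure P A"
    using assms A' by (subst nn_integral_mix[of P P]) auto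
  also have "\<dots> = (ennreal (1 - t) + ennreal t) * emeasure P A" by (simp add: distrib_right)
  also have "ennreal (1 - t) + ennreal t = 1" using assms by (simp flip: ennreal_plus)
  finally show "emeasure (mix t P P) A = emeasure P A" by simp
qed

section \<open>Transport cost, near-optimal couplings and the triangle inequality\<close>

context wasserstein_metric
begin

definition cost :: "('a \<times> 'a) measure \<Rightarrow> ennreal" where
  "cost \<pi> = (\<integral>\<^sup>+ z. ennreal (d (fst z) (snd z) powr p) \<partial>\<pi>)"

lemma W_nonneg [simp]: "0 \<le> W P Q"
  by (simp add: wasserstein_def)

lemma W_powr: "W P Q powr p = enn2real (INF \<pi>\<in>couplings N P Q. cost \<pi>)"
  using p_ge_1 by (simp add: wasserstein_def cost_def powr_powr)

lemma W_powr_le: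
  assumes "\<pi> \<in> couplings N P Q" "cost \<pi> \<le> ennreal c" "c \<ge> 0"
  shows "W P Q powr p \<le> c"
  unfolding W_powr using assms by (intro enn2real_leI) (auto intro: INF_lower2)

text \<open>Membership supplies a single base point. The estimate (u + v)^p <= 2^(p-1) (u^p + v^p),
  the weighted inequality at a = b = 1, moves it to any other point.\<close>

lemma moment_finite:
  assumes "P \<in> \<W>" "x \<in> M"
  shows "(\<integral>\<^sup>+ y. ennreal (d x y powr p) \<partial>P) < \<infinity>"
proof -
  interpret P: prob_space P using wasserstein_spaceD[OF assms(1)] by simp
  note [measurable_cong] = wasserstein_spaceD(2)[OF assms(1)]
  obtain x0 where x0: "x0 \<in> M" "(\<integral>\<^sup>+ y. ennreal (d x0 y powr p) \<partial>P) < \<infinity>"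
    using assms(1) by (auto simp: wasserstein_space_def)
  have [measurable]: "d x0 \<in> borel_measurable N" using x0 by simp
  have "(\<integral>\<^sup>+ y. ennreal (d x y powr p) \<partial>P)
      \<le> (\<integral>\<^sup>+ y. ennreal (2 powr (p - 1) * d x x0 powr p) + ennreal (2 powr (p - 1)) * ennreal (d x0 y powr p) \<partial>P)"
  proof (rule nn_integral_mono)
    fix y assume "y \<in> space P"
    then have y: "y \<in> M" using wasserstein_spaceD[OF assms(1)] by simp
    have "d x y powr p \<le> (d x x0 + d x0 y) powr p"
      using p_ge_1 y x0 assms by (intro powr_mono2 triangle) auto
    also have "\<dots> \<le> 2 powr (p - 1) * d x x0 powr p + 2 powr (p - 1) * d x0 y powr p"
      using powr_add_le_weighted[OF p_ge_1, of "d x x0" "d x0 y" 1 1] by (simp add: distrib_left)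
    finally show "ennreal (d x y powr p)
        \<le> ennreal (2 powr (p - 1) * d x x0 powr p) + ennreal (2 powr (p - 1)) * ennreal (d x0 y powr p)"
      by (simp add: ennreal_leI flip: ennreal_plus ennreal_mult)
  qed
  also have "\<dots> = ennreal (2 powr (p - 1) * d x x0 powr p)
      + ennreal (2 powr (p - 1)) * (\<integral>\<^sup>+ y. ennreal (d x0 y powr p) \<partial>P)"
    by (simp add: nn_integral_add nn_integral_cmult P.emeasure_space_1)
  also have "\<dots> < \<infinity>" using x0 by (simp add: ennreal_mult_less_top)
  finally show ?thesis .
qed

lemma pair_measure_in_couplings:
  assumes "P \<in> \<W>" "Q \<in> \<W>"
  shows "P \<Otimes>\<^sub>M Q \<in> couplings N P Q"
proof -
  interpret P: prob_space P using wasserstein_spaceD[OF assms(1)] by simp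
  interpret Q: prob_space Q using wasserstein_spaceD[OF assms(2)] by simp
  have pr: "prob_space (P \<Otimes>\<^sub>M Q)" by (rule prob_space_pair) unfold_locales
  note s = wasserstein_spaceD(2)[OF assms(1)] wasserstein_spaceD(2)[OF assms(2)]
  have "distr (P \<Otimes>\<^sub>M Q) P fst = P" by (rule Q.distr_pair_fst)
  moreover have "distr (P \<Otimes>\<^sub>M Q) Q snd = Q"
  proof (rule measure_eqI)
    fix A assume "A \<in> sets (distr (P \<Otimes>\<^sub>M Q) Q snd)"
    then have A: "A \<in> sets Q" by simp
    have "emeasure (distr (P \<Otimes>\<^sub>M Q) Q snd) A = emeasure (P \<Otimes>\<^sub>M Q) (space P \<times> A)"
      using A by (auto simp: emeasure_distr space_pair_measure dest: sets.sets_into_space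
          intro!: arg_cong2[where f=emeasure])
    also have "\<dots> = emeasure Q A" using A by (simp add: Q.emeasure_pair_measure_Times P.emeasure_space_1)
    finally show "emeasure (distr (P \<Otimes>\<^sub>M Q) Q snd) A = emeasure Q A" .
  qed simp
  moreover have "distr (P \<Otimes>\<^sub>M Q) N fst = distr (P \<Otimes>\<^sub>M Q) P fst" "distr (P \<Otimes>\<^sub>M Q) N snd = distr (P \<Otimes>\<^sub>M Q) Q snd"
    using s by (auto intro!: distr_cong)
  ultimately show ?thesis
    using s by (auto simp: couplings_def pr cong: sets_pair_measure_cong)
qed

text \<open>\<open>enn2real\<close> sends infinity to 0, so \<open>W\<close> reflects the infimum
  only once the infimum is known to be finite. The independent coupling is the witness, through the
  two moments at a common base point.\<close>

lemma transport_cost_finite: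
  assumes "P \<in> \<W>" "Q \<in> \<W>"
  shows "(INF \<pi>\<in>couplings N P Q. cost \<pi>) < \<infinity>"
proof -
  interpret P: prob_space P using wasserstein_spaceD[OF assms(1)] by simp
  note \<pi> = pair_measure_in_couplings[OF assms]
  note [measurable_cong] = couplingsD(2)[OF \<pi>]
  obtain x0 where x0: "x0 \<in> M" using P.not_empty wasserstein_spaceD[OF assms(1)] by auto
  have [measurable]: "d x0 \<in> borel_measurable N" using x0 by simp
  have "cost (P \<Otimes>\<^sub>M Q) \<le> (\<integral>\<^sup>+ z. ennreal (2 powr (p - 1)) * ennreal (d x0 (fst z) powr p)
      + ennreal (2 powr (p - 1)) * ennreal (d x0 (snd z) powr p) \<partial>(P \<Otimes>\<^sub>M Q))"
    unfolding cost_def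
  proof (rule nn_integral_mono)
    fix z assume "z \<in> space (P \<Otimes>\<^sub>M Q)"
    then have z: "fst z \<in> M" "snd z \<in> M" 
      using wasserstein_spaceD[OF assms(1)] wasserstein_spaceD[OF assms(2)] by (simp_all add: space_pair_measure mem_Times_iff)
    have "d (fst z) (snd z) powr p \<le> (d x0 (fst z) + d x0 (snd z)) powr p"
      using p_ge_1 z x0 triangle[of "fst z" x0 "snd z"] commute[of x0 "fst z"] by (intro powr_mono2) auto
    also have "\<dots> \<le> 2 powr (p - 1) * d x0 (fst z) powr p + 2 powr (p - 1) * d x0 (snd z) powr p"
      using powr_add_le_weighted[OF p_ge_1, of "d x0 (fst z)" "d x0 (snd z)" 1 1] by (simp add: distrib_left)
    finally show "ennreal (d (fst z) (snd z) powr p)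
        \<le> ennreal (2 powr (p - 1)) * ennreal (d x0 (fst z) powr p)
          + ennreal (2 powr (p - 1)) * ennreal (d x0 (snd z) powr p)"
      by (simp add: ennreal_leI flip: ennreal_plus ennreal_mult)
  qed
  also have "\<dots> = ennreal (2 powr (p - 1)) * (\<integral>\<^sup>+ x. ennreal (d x0 x powr p) \<partial>P)
      + ennreal (2 powr (p - 1)) * (\<integral>\<^sup>+ x. ennreal (d x0 x powr p) \<partial>Q)"
    by (simp add: nn_integral_add nn_integral_cmult
        couplings_marginals[OF \<pi>, of "\<lambda>x. ennreal (d x0 x powr p)"])
  also have "\<dots> < \<infinity>"
    using moment_finite[OF assms(1) x0] moment_finite[OF assms(2) x0] by (simp add: ennreal_mult_less_top)
  finally have "cost (P \<Otimes>\<^sub>M Q) < \<infinity>" .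
  then show ?thesis using \<pi> by (meson INF_lower2 le_less_trans order_refl)
qed

text \<open>A slack \<open>e\<close> stands in for attainment of the infimum, so that no compactness
  of the set of couplings has to be established.\<close>

lemma near_optimal_coupling:
  assumes "P \<in> \<W>" "Q \<in> \<W>" "e > 0"
  obtains \<pi> where "\<pi> \<in> couplings N P Q" "cost \<pi> \<le> ennreal (W P Q powr p + e)"
proof -
  let ?I = "INF \<pi>\<in>couplings N P Q. cost \<pi>"
  have "?I = ennreal (enn2real ?I)" using transport_cost_finite[OF assms(1,2)] by simp
  also have "\<dots> < ennreal (W P Q powr p + e)"
    unfolding W_powr using assms(3) by (intro ennreal_lessI) (auto simp: add_nonneg_pos)
  finally show ?thesis unfolding INF_less_iff using that less_imp_le by blast
qed

lemma W_commute: "W P Q = W Q P"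
proof -
  have *: "(INF \<pi>\<in>couplings N Q P. cost \<pi>) \<le> (INF \<pi>\<in>couplings N P Q. cost \<pi>)" for P Q
  proof (rule INF_greatest)
    fix \<pi> assume \<pi>: "\<pi> \<in> couplings N P Q"
    note [measurable_cong] = couplingsD(2)[OF \<pi>]
    have "cost (distr \<pi> (N \<Otimes>\<^sub>M N) (\<lambda>z. (snd z, fst z))) = cost \<pi>"
      unfolding cost_def by (subst nn_integral_distr) (auto simp: commute)
    then show "(INF \<pi>\<in>couplings N Q P. cost \<pi>) \<le> cost \<pi>"
      using INF_lower[OF distr_snd_fst_swap[OF \<pi>], of cost] by simp
  qed
  show ?thesis unfolding wasserstein_def cost_def[symmetric] antisym[OF *[of P Q] *[of Q P]] ..
qed

lemma W_triangle:
  assumes "P \<in> \<W>" "Q \<in> \<W>" "R \<in> \<W>"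
  shows "W P R \<le> W P Q + W Q R"
proof (rule field_le_epsilon)
  fix \<eta> :: real assume "\<eta> > 0"
  \<comment> \<open>Three errors add up: the slack in \<open>a\<close>, the slack in
    \<open>b\<close> and the diameter of the cells.\<close>
  define e where "e = \<eta> / 3"
  then have e: "e > 0" using \<open>\<eta> > 0\<close> by simp
  define a where "a = W P Q + e"
  define b where "b = W Q R + e"
  have ab: "a > 0" "b > 0" using e by (auto simp: a_def b_def add_nonneg_pos)
  have "a powr p - W P Q powr p > 0" "b powr p - W Q R powr p > 0"
    using e p_ge_1 by (auto simp: a_def b_def intro!: powr_less_mono2)
  note near_optimal_coupling[OF assms(1,2) this(1)] near_optimal_coupling[OF assms(2,3) this(2)]
  then obtain \<pi> \<sigma> where \<pi>: "\<pi> \<in> couplings N P Q" "cost \<pi> \<le> ennreal (a powr p)"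
      and \<sigma>: "\<sigma> \<in> couplings N Q R" "cost \<sigma> \<le> ennreal (b powr p)"
    by (metis add_diff_cancel_left' add_diff_eq)
  obtain i where i: "i \<in> measurable N (count_space (UNIV :: nat set))"
      "\<And>x y. x \<in> M \<Longrightarrow> y \<in> M \<Longrightarrow> i x = i y \<Longrightarrow> d x y < e"
    using fine_partition[OF e] by blast
  obtain \<Gamma> where \<Gamma>: "sets \<Gamma> = sets ((N \<Otimes>\<^sub>M N) \<Otimes>\<^sub>M (N \<Otimes>\<^sub>M N))"
    "\<And>f. f \<in> borel_measurable (N \<Otimes>\<^sub>M N) \<Longrightarrow> (\<integral>\<^sup>+ z. f (fst z) \<partial>\<Gamma>) = (\<integral>\<^sup>+ z. f z \<partial>\<pi>)"
    "\<And>f. f \<in> borel_measurable (N \<Otimes>\<^sub>M N) \<Longrightarrow> (\<integral>\<^sup>+ z. f (snd z) \<partial>\<Gamma>) = (\<integral>\<^sup>+ z. f z \<partial>\<sigma>)"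
    "AE z in \<Gamma>. i (snd (fst z)) = i (fst (snd z))"
    by (rule couplings_glue[OF \<pi>(1) \<sigma>(1) i(1)]) blast
  note [measurable_cong] = \<Gamma>(1)
  have sp: "space \<Gamma> = (M \<times> M) \<times> (M \<times> M)"
    using sets_eq_imp_space_eq[OF \<Gamma>(1)] by (simp add: space_pair_measure)
  have "emeasure \<Gamma> (space \<Gamma>) = (\<integral>\<^sup>+ z. 1 \<partial>\<pi>)"
    using \<Gamma>(2)[of "\<lambda>_. 1"] by simp
  then have pG: "emeasure \<Gamma> (space \<Gamma>) = 1"
    using couplingsD(1)[OF \<pi>(1)] by (simp add: prob_space.emeasure_space_1)
  then interpret \<Gamma>: prob_space \<Gamma> by (rule prob_spaceI)
  define \<tau> where "\<tau> = distr \<Gamma> (N \<Otimes>\<^sub>M N) (\<lambda>z. (fst (fst z), snd (snd z)))"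
  have "distr \<tau> N fst = P"
  proof (rule measure_eqI)
    show "sets (distr \<tau> N fst) = sets P" using wasserstein_spaceD[OF assms(1)] by simp
    fix A assume "A \<in> sets (distr \<tau> N fst)"
    then have A [measurable]: "A \<in> sets N" by simp
    have "emeasure (distr \<tau> N fst) A = (\<integral>\<^sup>+ z. indicator A (fst (fst z)) \<partial>\<Gamma>)"
      unfolding \<tau>_def by (subst distr_distr) (auto simp: comp_def nn_integral_distr simp flip: nn_integral_indicator)
    also have "\<dots> = (\<integral>\<^sup>+ z. indicator A (fst z) \<partial>\<pi>)" by (rule \<Gamma>(2)) measurable
    also have "\<dots> = (\<integral>\<^sup>+ x. indicator A x \<partial>P)" by (rule couplings_marginals(1)[OF \<pi>(1)]) measurable
    finally show "emeasure (distr \<tau> N fst) A = emeasure P A" using A wasserstein_spaceD[OF assms(1)] by simp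
  qed
  moreover have "distr \<tau> N snd = R"
  proof (rule measure_eqI)
    show "sets (distr \<tau> N snd) = sets R" using wasserstein_spaceD[OF assms(3)] by simp
    fix A assume "A \<in> sets (distr \<tau> N snd)"
    then have A [measurable]: "A \<in> sets N" by simp
    have "emeasure (distr \<tau> N snd) A = (\<integral>\<^sup>+ z. indicator A (snd (snd z)) \<partial>\<Gamma>)"
      unfolding \<tau>_def by (subst distr_distr) (auto simp: comp_def nn_integral_distr simp flip: nn_integral_indicator)
    also have "\<dots> = (\<integral>\<^sup>+ z. indicator A (snd z) \<partial>\<sigma>)" by (rule \<Gamma>(3)) measurable
    also have "\<dots> = (\<integral>\<^sup>+ x. indicator A x \<partial>R)" by (rule couplings_marginals(2)[OF \<sigma>(1)]) measurable
    finally show "emeasure (distr \<tau> N snd) A = emeasure R A" using A wasserstein_spaceD[OF assms(3)] by simp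
  qed
  moreover have "prob_space \<tau>" unfolding \<tau>_def by (rule \<Gamma>.prob_space_distr) measurable
  ultimately have \<tau>: "\<tau> \<in> couplings N P R" by (auto simp: couplings_def \<tau>_def)
  define s where "s = a + e + b"
  have s: "s > 0" using ab e by (simp add: s_def)
  \<comment> \<open>The coefficients come from applying the weighted inequality twice to
    \<open>x + (e + y)\<close> with weights \<open>a\<close>, \<open>e\<close>, \<open>b\<close>.
    The distance between the two middle coordinates is below \<open>e\<close> and contributes
    \<open>e powr p / e powr (p - 1) = e\<close>, whence \<open>E\<close>. After integration the
    terms recombine to exactly \<open>s powr p\<close>.\<close>
  define A where "A = s powr (p - 1) / a powr (p - 1)"
  define B where "B = s powr (p - 1) / b powr (p - 1)"
  define E where "E = s powr (p - 1) * e"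
  have ABE: "A \<ge> 0" "B \<ge> 0" "E \<ge> 0" using e by (auto simp: A_def B_def E_def)
  have "cost \<tau> = (\<integral>\<^sup>+ z. ennreal (d (fst (fst z)) (snd (snd z)) powr p) \<partial>\<Gamma>)"
    unfolding cost_def \<tau>_def by (subst nn_integral_distr) auto
  also have "\<dots> \<le> (\<integral>\<^sup>+ z. ennreal A * ennreal (d (fst (fst z)) (snd (fst z)) powr p)
      + ennreal E + ennreal B * ennreal (d (fst (snd z)) (snd (snd z)) powr p) \<partial>\<Gamma>)"
  proof (rule nn_integral_mono_AE, use \<Gamma>(4) AE_space in eventually_elim)
    fix z assume z: "i (snd (fst z)) = i (fst (snd z))" "z \<in> space \<Gamma>"
    obtain x y y' v where zz: "z = ((x, y), (y', v))" by (metis surj_pair)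
    have M: "x \<in> M" "y \<in> M" "y' \<in> M" "v \<in> M" using z zz sp by auto
    have "d y y' < e" using i(2) M z zz by auto
    then have "d x v \<le> d x y + (e + d y' v)"
      using triangle[of x y v] triangle[of y y' v] M by simp
    then have "d x v powr p \<le> (d x y + (e + d y' v)) powr p" using p_ge_1 by (intro powr_mono2) auto
    also have "\<dots> \<le> (a + (e + b)) powr (p - 1)
        * (d x y powr p / a powr (p - 1) + (e + d y' v) powr p / (e + b) powr (p - 1))"
      using e ab p_ge_1 by (intro powr_add_le_weighted) auto
    also have "\<dots> \<le> (a + (e + b)) powr (p - 1)
        * (d x y powr p / a powr (p - 1) + (e powr p / e powr (p - 1) + d y' v powr p / b powr (p - 1)))"
      using powr_add_le_weighted[OF p_ge_1, of e "d y' v" e b] e ab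
      by (intro mult_left_mono add_left_mono) (auto simp: pos_divide_le_eq mult.commute)
    also have "e powr p / e powr (p - 1) = e" using e by (simp add: powr_diff)
    also have "(a + (e + b)) powr (p - 1) * (d x y powr p / a powr (p - 1) + (e + d y' v powr p / b powr (p - 1)))
        = A * d x y powr p + E + B * d y' v powr p"
      by (simp add: A_def B_def E_def s_def distrib_left add.assoc)
    finally show "ennreal (d (fst (fst z)) (snd (snd z)) powr p)
        \<le> ennreal A * ennreal (d (fst (fst z)) (snd (fst z)) powr p) + ennreal E
          + ennreal B * ennreal (d (fst (snd z)) (snd (snd z)) powr p)"
      using ABE by (simp add: zz ennreal_leI flip: ennreal_plus ennreal_mult)
  qed
  also have "\<dots> = ennreal A * (\<integral>\<^sup>+ z. ennreal (d (fst (fst z)) (snd (fst z)) powr p) \<partial>\<Gamma>)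
      + ennreal E + ennreal B * (\<integral>\<^sup>+ z. ennreal (d (fst (snd z)) (snd (snd z)) powr p) \<partial>\<Gamma>)"
    by (simp add: nn_integral_add nn_integral_cmult \<Gamma>.emeasure_space_1)
  also have "(\<integral>\<^sup>+ z. ennreal (d (fst (fst z)) (snd (fst z)) powr p) \<partial>\<Gamma>) = cost \<pi>"
    unfolding cost_def by (rule \<Gamma>(2)) measurable
  also have "(\<integral>\<^sup>+ z. ennreal (d (fst (snd z)) (snd (snd z)) powr p) \<partial>\<Gamma>) = cost \<sigma>"
    unfolding cost_def by (rule \<Gamma>(3)) measurable
  also have "ennreal A * cost \<pi> + ennreal E + ennreal B * cost \<sigma>
      \<le> ennreal A * ennreal (a powr p) + ennreal E + ennreal B * ennreal (b powr p)"
    by (intro add_mono mult_left_mono \<pi> \<sigma>) auto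
  also have "\<dots> = ennreal (A * a powr p + E + B * b powr p)"
    using ABE by (simp flip: ennreal_plus ennreal_mult)
  also have "A * a powr p + E + B * b powr p = s powr p"
  proof -
    have "A * a powr p = s powr (p - 1) * a" "B * b powr p = s powr (p - 1) * b"
      using ab by (auto simp: A_def B_def powr_diff)
    then have "A * a powr p + E + B * b powr p = s powr (p - 1) * s"
      by (simp add: E_def s_def distrib_left)
    then show ?thesis using s by (simp add: powr_diff)
  qed
  finally have "W P R powr p \<le> s powr p" by (intro W_powr_le[OF \<tau>]) auto
  then have "W P R \<le> s" using s p_ge_1 by (meson W_nonneg less_le_trans less_imp_le not_le powr_less_mono2 zero_less_one)
  then show "W P R \<le> W P Q + W Q R + \<eta>" by (simp add: s_def a_def b_def e_def)
qed

end

section \<open>The Wasserstein metric\<close>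

context wasserstein_metric
begin

lemma W_self: assumes "P \<in> \<W>" shows "W P P = 0"
proof -
  interpret prob_space P using wasserstein_spaceD[OF assms] by simp
  note [measurable_cong] = wasserstein_spaceD(2)[OF assms]
  let ?\<delta> = "distr P (N \<Otimes>\<^sub>M N) (\<lambda>x. (x, x))"
  have \<delta>: "?\<delta> \<in> couplings N P P"
    using wasserstein_spaceD(2)[OF assms]
    by (auto simp: couplings_def distr_distr comp_def intro!: prob_space_distr distr_id2)
  have "cost ?\<delta> = (\<integral>\<^sup>+ x. ennreal (d x x powr p) \<partial>P)"
    unfolding cost_def by (subst nn_integral_distr) auto
  also have "\<dots> = (\<integral>\<^sup>+ x. 0 \<partial>P)"
    using wasserstein_spaceD(3)[OF assms] p_ge_1 by (intro nn_integral_cong) auto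
  finally have "W P P powr p \<le> 0" by (intro W_powr_le[OF \<delta>]) auto
  then show ?thesis by (metis powr_nonneg_iff)
qed

text \<open>Under a coupling, the first coordinate can lie in \<open>F\<close> while the second is
  outside the \<open>1 / Suc n\<close>-neighbourhood of \<open>F\<close> only if the two are at
  least \<open>1 / Suc n\<close> apart. Markov's inequality makes this arbitrarily unlikely when the
  cost can be made arbitrarily small, and the neighbourhoods shrink to \<open>F\<close> because
  \<open>F\<close> is closed.\<close>

lemma W_0_closed_le:
  assumes "P \<in> \<W>" "Q \<in> \<W>" "W P Q = 0" and F: "closedin mtopology F"
  shows "emeasure P F \<le> emeasure Q F"
proof (cases "F = {}")
  case False
  interpret Q: prob_space Q using wasserstein_spaceD[OF assms(2)] by simp
  have FM: "F \<subseteq> M" using F closedin_subset by fastforce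
  have "M - F \<in> sets N" using F by (intro open_in_sets) auto
  moreover have "F = space N - (M - F)" using FM by auto
  ultimately have F_sets [measurable]: "F \<in> sets N" by (metis sets.compl_sets)
  define G where "G n = (\<Union>x\<in>F. mball x (1 / Suc n))" for n
  have G_sets [measurable]: "G n \<in> sets N" for n
    unfolding G_def by (intro open_in_sets openin_Union) (auto simp: openin_mball)
  have G_dist: "y \<in> G n \<longleftrightarrow> (\<exists>x\<in>F. y \<in> M \<and> d x y < 1 / Suc n)" for y n
    using FM by (auto simp: G_def in_mball)
  have "decseq G"
    by (auto simp: decseq_def G_dist) (smt (verit) frac_le of_nat_0_le_iff of_nat_mono)
  have "(\<Inter>n. G n) = F"
  proof
    have "x \<in> G n" if "x \<in> F" for x n
    proof -
      have "x \<in> M" "d x x = 0" using that FM by auto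
      then show ?thesis using that unfolding G_dist by (auto intro!: bexI[of _ x])
    qed
    then show "F \<subseteq> (\<Inter>n. G n)" by auto
    show "(\<Inter>n. G n) \<subseteq> F"
    proof
      fix y assume y: "y \<in> (\<Inter>n. G n)"
      then have "y \<in> M" using G_dist by blast
      have "y \<in> mtopology closure_of F"
        unfolding metric_closure_of
      proof (clarsimp simp: \<open>y \<in> M\<close> in_mball)
        fix r :: real assume "r > 0"
        then obtain n where n: "1 / Suc n < r" using nat_approx_posE by blast
        obtain x where "x \<in> F" "d x y < 1 / Suc n" using y G_dist by blast
        then show "\<exists>x\<in>F. x \<in> M \<and> d y x < r" using n FM by (metis commute less_trans subsetD)
      qed
      then show "y \<in> F" using F by (simp add: closure_of_closedin)
    qed
  qed
  moreover have "(\<lambda>n. emeasure Q (G n)) \<longlonglongrightarrow> emeasure Q (\<Inter>n. G n)"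
    using wasserstein_spaceD(2)[OF assms(2)] \<open>decseq G\<close> G_sets Q.emeasure_finite
    by (intro Lim_emeasure_decseq) (blast, blast, simp)
  moreover have "emeasure P F \<le> emeasure Q (G n)" for n
  proof (rule ennreal_le_epsilon)
    fix e :: real assume "e > 0"
    \<comment> \<open>The least cost of a displacement by \<open>1 / Suc n\<close>. A coupling of
      cost at most \<open>e * s\<close> makes such displacements with probability at most
      \<open>e\<close>.\<close>
    define s where "s = (1 / Suc n) powr p"
    have s: "s > 0" by (simp add: s_def)
    obtain \<pi> where \<pi>: "\<pi> \<in> couplings N P Q" "cost \<pi> \<le> ennreal (W P Q powr p + e * s)"
      using near_optimal_coupling[OF assms(1,2) mult_pos_pos[OF \<open>e > 0\<close> s]] by blast
    interpret \<pi>: prob_space \<pi> using couplingsD[OF \<pi>(1)] by simp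
    note [measurable_cong] = couplingsD(2)[OF \<pi>(1)]
    have "emeasure P F = (\<integral>\<^sup>+ z. indicator F (fst z) \<partial>\<pi>)"
      using wasserstein_spaceD(2)[OF assms(1)] F_sets by (subst couplings_marginals(1)[OF \<pi>(1)]) auto
    also have "\<dots> \<le> (\<integral>\<^sup>+ z. indicator (G n) (snd z) + ennreal (1 / s) * ennreal (d (fst z) (snd z) powr p) \<partial>\<pi>)"
    proof (rule nn_integral_mono)
      fix z assume "z \<in> space \<pi>"
      then have z: "snd z \<in> M" using couplingsD(3)[OF \<pi>(1)] space_N by (metis SigmaE snd_conv)
      show "(indicator F (fst z) :: ennreal)
          \<le> indicator (G n) (snd z) + ennreal (1 / s) * ennreal (d (fst z) (snd z) powr p)"
      proof (cases "fst z \<in> F \<and> snd z \<notin> G n")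
        case True
        then have "d (fst z) (snd z) \<ge> 1 / Suc n" using G_dist z by (meson not_le)
        then have "s \<le> d (fst z) (snd z) powr p" unfolding s_def using p_ge_1 by (intro powr_mono2) auto
        then have "1 \<le> 1 / s * (d (fst z) (snd z) powr p)" using s by (simp add: field_simps)
        then have "ennreal 1 \<le> ennreal (1 / s) * ennreal (d (fst z) (snd z) powr p)"
          using s by (subst ennreal_mult[symmetric]) (auto intro: ennreal_leI)
        then show ?thesis using True by simp
      qed (auto simp: indicator_def)
    qed
    also have "\<dots> = (\<integral>\<^sup>+ z. indicator (G n) (snd z) \<partial>\<pi>) + ennreal (1 / s) * cost \<pi>"
      unfolding cost_def by (subst nn_integral_add) (auto simp: nn_integral_cmult)
    also have "(\<integral>\<^sup>+ z. indicator (G n) (snd z) \<partial>\<pi>) = emeasure Q (G n)"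
      using wasserstein_spaceD(2)[OF assms(2)] by (subst couplings_marginals(2)[OF \<pi>(1)]) auto
    also have "ennreal (1 / s) * cost \<pi> \<le> ennreal (1 / s) * ennreal (e * s)"
      using \<pi>(2) assms(3) by (intro mult_left_mono) auto
    also have "\<dots> = ennreal e" using s \<open>e > 0\<close> by (simp flip: ennreal_mult)
    finally show "emeasure P F \<le> emeasure Q (G n) + ennreal e" by (simp add: add_left_mono)
  qed
  ultimately show ?thesis by (intro LIMSEQ_le_const) auto
qed simp

text \<open>The one-sided bound in both directions gives equality on closed sets. Complements turn
  this into equality on open sets, which form an intersection-stable generator.\<close>

lemma W_eq_0_iff:
  assumes "P \<in> \<W>" "Q \<in> \<W>"
  shows "W P Q = 0 \<longleftrightarrow> P = Q"
proof
  assume "W P Q = 0"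
  then have eq: "emeasure P F = emeasure Q F" if "closedin mtopology F" for F
    using W_0_closed_le[OF assms] W_0_closed_le[OF assms(2,1)] that by (simp add: W_commute order_antisym)
  interpret P: prob_space P using wasserstein_spaceD[OF assms(1)] by simp
  interpret Q: prob_space Q using wasserstein_spaceD[OF assms(2)] by simp
  let ?E = "{S. openin mtopology S}"
  have Pow: "?E \<subseteq> Pow M" using openin_subset by fastforce
  have sets: "sets P = sigma_sets M ?E" "sets Q = sigma_sets M ?E"
    using wasserstein_spaceD(2)[OF assms(1)] wasserstein_spaceD(2)[OF assms(2)] Pow by (simp_all add: metric_borel_def)
  show "P = Q"
  proof (rule measure_eqI_generator_eq[where E="?E" and \<Omega>=M and A="\<lambda>_. M"])
    fix X assume "X \<in> ?E"
    then have X: "openin mtopology X" by simp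
    have XM: "X \<subseteq> M" using X openin_subset by fastforce
    have "X \<in> sets N" using X by (rule open_in_sets)
    then have X': "X \<in> P.events" "X \<in> Q.events" using wasserstein_spaceD[OF assms(1)] wasserstein_spaceD[OF assms(2)] by auto
    have "emeasure P (M - X) = emeasure Q (M - X)" using X by (intro eq) auto
    then have "P.prob (M - X) = Q.prob (M - X)" by (simp add: measure_def)
    then have "P.prob X = Q.prob X"
      using P.prob_compl[OF X'(1)] Q.prob_compl[OF X'(2)] wasserstein_spaceD(3)[OF assms(1)] wasserstein_spaceD(3)[OF assms(2)] by simp
    then show "emeasure P X = emeasure Q X" by (simp add: P.emeasure_eq_measure Q.emeasure_eq_measure)
  qed (use sets Pow in \<open>auto simp: Int_stable_def P.emeasure_eq_measure\<close>)
qed (use W_self assms in auto)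

lemma Metric_space_W: "Metric_space \<W> W"
  by unfold_locales (auto simp: W_eq_0_iff W_triangle intro: W_commute)

sublocale W: Metric_space \<W> W
  by (rule Metric_space_W)

section \<open>Mixtures inside the Wasserstein space\<close>

lemma mix_in_W:
  assumes "P \<in> \<W>" "Q \<in> \<W>" "0 \<le> t" "t \<le> 1"
  shows "mix t P Q \<in> \<W>"
proof -
  note P = wasserstein_spaceD[OF assms(1)] and Q = wasserstein_spaceD[OF assms(2)]
  obtain x where x: "x \<in> M" using P by (metis prob_space.not_empty ex_in_conv)
  then have [measurable]: "d x \<in> borel_measurable N" by simp
  have "(\<integral>\<^sup>+ y. ennreal (d x y powr p) \<partial>mix t P Q) < \<infinity>"
    using moment_finite[OF assms(1) x] moment_finite[OF assms(2) x] assms(3,4)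
    by (subst nn_integral_mix[OF P(1,2) Q(1,2)]) (auto simp: ennreal_mult_less_top)
  then show ?thesis
    using x sets_mix[OF P(1,2) Q(1,2)] prob_space_mix[OF P(1,2) Q(1,2)]
    by (auto simp: wasserstein_space_def)
qed

text \<open>Mixing near-optimal couplings of \<open>P\<close> with \<open>R\<close> and of
  \<open>Q\<close> with \<open>R\<close> yields a coupling of the mixture with \<open>R\<close>, and
  the cost is linear in the coupling.\<close>

lemma W_mix_le:
  assumes "P \<in> \<W>" "Q \<in> \<W>" "R \<in> \<W>" "0 \<le> t" "t \<le> 1"
  shows "W (mix t P Q) R powr p \<le> (1 - t) * W P R powr p + t * W Q R powr p"
proof (rule field_le_epsilon)
  fix e :: real assume e: "e > 0"
  obtain \<pi> where \<pi>: "\<pi> \<in> couplings N P R" "cost \<pi> \<le> ennreal (W P R powr p + e)"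
    using near_optimal_coupling[OF assms(1,3) e] by blast
  obtain \<sigma> where \<sigma>: "\<sigma> \<in> couplings N Q R" "cost \<sigma> \<le> ennreal (W Q R powr p + e)"
    using near_optimal_coupling[OF assms(2,3) e] by blast
  note m = couplingsD(1,2)[OF \<pi>(1)] couplingsD(1,2)[OF \<sigma>(1)]
  have "mix t \<pi> \<sigma> \<in> couplings N (mix t P Q) R"
    using sets_mix[OF m] prob_space_mix[OF m] distr_mix[OF m, of fst N] distr_mix[OF m, of snd N]
      couplingsD(4,5)[OF \<pi>(1)] couplingsD(4,5)[OF \<sigma>(1)] wasserstein_spaceD(1)[OF assms(3)] assms(4,5)
    by (simp add: couplings_def mix_same)
  moreover have "cost (mix t \<pi> \<sigma>) \<le> ennreal ((1 - t) * (W P R powr p + e) + t * (W Q R powr p + e))"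
  proof -
    have "cost (mix t \<pi> \<sigma>) = ennreal (1 - t) * cost \<pi> + ennreal t * cost \<sigma>"
      unfolding cost_def using assms by (intro nn_integral_mix[OF m]) auto
    also have "\<dots> \<le> ennreal (1 - t) * ennreal (W P R powr p + e) + ennreal t * ennreal (W Q R powr p + e)"
      by (intro add_mono mult_left_mono \<pi> \<sigma>) auto
    finally show ?thesis using assms e by (simp add: ennreal_mult ennreal_plus)
  qed
  ultimately have "W (mix t P Q) R powr p \<le> (1 - t) * (W P R powr p + e) + t * (W Q R powr p + e)"
    using assms e by (intro W_powr_le) auto
  then show "W (mix t P Q) R powr p \<le> (1 - t) * W P R powr p + t * W Q R powr p + e"
    by (simp add: algebra_simps)
qed

lemma integral_mix_close:
  fixes h :: "'a \<Rightarrow> real"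
  assumes "P \<in> \<W>" "Q \<in> \<W>" "0 \<le> t" "t \<le> 1" and B: "\<And>x. x \<in> M \<Longrightarrow> \<bar>h x\<bar> \<le> B"
  shows "\<bar>(\<integral> x. h x \<partial>mix t P Q) - (\<integral> x. h x \<partial>P)\<bar> \<le> 2 * t * B"
proof -
  note P = wasserstein_spaceD[OF assms(1)] and Q = wasserstein_spaceD[OF assms(2)]
  interpret P: prob_space P by (rule P)
  interpret Q: prob_space Q by (rule Q)
  have "B \<ge> 0" using B P.not_empty P(3) by fastforce
  show ?thesis
  proof (cases "h \<in> borel_measurable N")
    case True
    have "\<bar>\<integral> x. h x \<partial>R\<bar> \<le> B" if R: "prob_space R" "sets R = sets N" "space R = M" for R
    proof -
      interpret R: prob_space R by (rule R)
      have "h \<in> borel_measurable R" using True R(2) measurable_cong_sets by blast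
      then have "integrable R h" using B R(3) by (auto intro!: R.integrable_const_bound[of _ B])
      then have "(\<integral> x. \<bar>h x\<bar> \<partial>R) \<le> B" using B R(3) by (intro R.integral_le_const) auto
      then show ?thesis using integral_abs_bound[of R h] by linarith
    qed
    from this[OF P] this[OF Q]
    have "\<bar>(\<integral> x. h x \<partial>Q) - (\<integral> x. h x \<partial>P)\<bar> \<le> 2 * B" by linarith
    moreover have "(\<integral> x. h x \<partial>mix t P Q) - (\<integral> x. h x \<partial>P) = t * ((\<integral> x. h x \<partial>Q) - (\<integral> x. h x \<partial>P))"
      using True B assms by (subst integral_mix[OF P(1,2) Q(1,2), of h B]) (auto simp: algebra_simps)
    ultimately show ?thesis using assms
      by (simp add: abs_mult mult.assoc mult.left_commute mult_left_mono)
  next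
    \<comment> \<open>Both integrals are now the default value 0: \<open>mix\<close> keeps the
      sigma-algebra, so \<open>h\<close> is integrable for neither measure.\<close>
    case False
    have "(\<integral> x. h x \<partial>R) = 0" if "sets R = sets N" for R
      using False that measurable_cong_sets[OF that refl]
      by (intro not_integrable_integral_eq) (auto dest: borel_measurable_integrable)
    then show ?thesis using \<open>B \<ge> 0\<close> assms sets_mix[OF P(1,2) Q(1,2)] P(2) by simp
  qed
qed

end

section \<open>Intersections of Wasserstein balls\<close>

context wasserstein_metric
begin

text \<open>The induction carries an open set rather than a point: all its members satisfy the
  strict bounds obtained so far, so a move inside it keeps them. Moving towards \<open>P j\<close>
  multiplies the p-th power of the distance to \<open>P j\<close> by at most \<open>1 - t\<close>,
  which makes that bound strict as well.\<close>

lemma slater_point: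
  assumes I: "finite I" "\<And>k. k \<in> I \<Longrightarrow> P k \<in> \<W>" "\<And>k. k \<in> I \<Longrightarrow> \<epsilon> k > 0"
    and U: "openin W.mtopology U" "U \<noteq> {}" "\<And>Q k. Q \<in> U \<Longrightarrow> k \<in> I \<Longrightarrow> W Q (P k) \<le> \<epsilon> k"
  obtains Q where "Q \<in> \<W>" "\<And>k. k \<in> I \<Longrightarrow> W Q (P k) < \<epsilon> k"
proof -
  have "J \<subseteq> I \<Longrightarrow> \<exists>V. openin W.mtopology V \<and> V \<noteq> {} \<and> V \<subseteq> U \<and> (\<forall>Q\<in>V. \<forall>k\<in>J. W Q (P k) < \<epsilon> k)"
    if "finite J" for J
    using that
  proof (induction J)
    case empty
    then show ?case using U by auto
  next
    case (insert j J)
    then obtain V where V: "openin W.mtopology V" "V \<noteq> {}" "V \<subseteq> U" "\<forall>Q\<in>V. \<forall>k\<in>J. W Q (P k) < \<epsilon> k"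
      by auto
    have j: "P j \<in> \<W>" "\<epsilon> j > 0" "j \<in> I" using I insert.prems by auto
    obtain Q where Q: "Q \<in> V" using V by auto
    then obtain r where r: "r > 0" "W.mball Q r \<subseteq> V" using V(1) unfolding W.openin_mtopology by blast
    have QW: "Q \<in> \<W>" using Q V(1) W.openin_mtopology by auto
    define c where "c = W (P j) Q powr p"
    \<comment> \<open>The displacement satisfies \<open>W R Q powr p \<le> t * c\<close>, and this
      choice forces \<open>t * c < r powr p\<close>, so that \<open>R\<close> stays in
      \<open>V\<close>. Adding 1 covers the case \<open>c = 0\<close>.\<close>
    define t where "t = min 1 (r powr p / (2 * (c + 1)))"
    have c: "c \<ge> 0" by (simp add: c_def)
    have t: "0 < t" "t \<le> 1" using r c by (auto simp: t_def)
    have "t * c \<le> r powr p / (2 * (c + 1)) * c" using c by (intro mult_right_mono) (auto simp: t_def)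
    also have "\<dots> < r powr p" using c r by (simp add: divide_simps)
    finally have tc: "t * c < r powr p" .
    define R where "R = mix t Q (P j)"
    have RW: "R \<in> \<W>" unfolding R_def using QW j t by (intro mix_in_W) auto
    have "W R Q powr p \<le> t * c"
      using W_mix_le[OF QW j(1) QW, of t] t QW p_ge_1 by (simp add: R_def c_def)
    then have "W R Q powr p < r powr p" using tc by simp
    then have "W R Q < r" using r p_ge_1 powr_mono2[of p r "W R Q"] by force
    then have RV: "R \<in> V" using r(2) QW RW by (auto simp: W.in_mball W_commute)
    have "W R (P j) powr p \<le> (1 - t) * W Q (P j) powr p"
      using W_mix_le[OF QW j(1) j(1), of t] t j p_ge_1 by (simp add: R_def)
    also have "\<dots> \<le> (1 - t) * \<epsilon> j powr p"
      using U(3)[of Q j] V(3) Q j t p_ge_1 by (intro mult_left_mono powr_mono2) auto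
    also have "\<dots> < \<epsilon> j powr p" using t j by (simp add: algebra_simps)
    finally have "W R (P j) < \<epsilon> j" using j p_ge_1 powr_mono2[of p "\<epsilon> j" "W R (P j)"] by force
    then have "R \<in> V \<inter> W.mball (P j) (\<epsilon> j)" using RV RW j by (auto simp: W.in_mball W_commute)
    moreover have "openin W.mtopology (V \<inter> W.mball (P j) (\<epsilon> j))" using V(1) by (intro openin_Int) auto
    ultimately show ?case
      using V by (intro exI[of _ "V \<inter> W.mball (P j) (\<epsilon> j)"]) (auto simp: W.in_mball W_commute)
  qed
  from this[OF I(1)] obtain V where "openin W.mtopology V" "V \<noteq> {}" "\<forall>Q\<in>V. \<forall>k\<in>I. W Q (P k) < \<epsilon> k"
    by auto
  then show thesis using that W.openin_mtopology by (metis ex_in_conv subsetD)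
qed

text \<open>At \<open>r = 0\<close> the required inequality between p-th powers is strict because
  \<open>Q0\<close> is strictly inside; continuity keeps it for small \<open>r\<close>, and finitely
  many \<open>k\<close> share one \<open>r\<close>. Slack is placed at both ends so that a shift of
  the centre can be absorbed before as well as after mixing.\<close>

lemma mix_slater_contracts:
  assumes I: "finite I" "\<And>k. k \<in> I \<Longrightarrow> P k \<in> \<W>"
    and Q0: "Q0 \<in> \<W>" "\<And>k. k \<in> I \<Longrightarrow> W Q0 (P k) < \<epsilon> k"
    and t: "0 < t" "t \<le> 1"
  obtains r where "r > 0"
    "\<And>Q k. Q \<in> \<W> \<Longrightarrow> k \<in> I \<Longrightarrow> W Q (P k) \<le> \<epsilon> k + r \<Longrightarrow> W (mix t Q Q0) (P k) \<le> \<epsilon> k - r"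
proof -
  \<comment> \<open>The condition \<open>r < \<epsilon> k\<close> keeps the base
    \<open>\<epsilon> k - r\<close> positive, so that the bound between powers can be read as one
    between distances.\<close>
  have "\<forall>\<^sub>F r in at_right 0. \<forall>k\<in>I. r < \<epsilon> k \<and>
      (1 - t) * (\<epsilon> k + r) powr p + t * W Q0 (P k) powr p < (\<epsilon> k - r) powr p"
  proof (rule eventually_ball_finite[OF I(1)], intro ballI eventually_conj)
    fix k assume k: "k \<in> I"
    then have w: "W Q0 (P k) < \<epsilon> k" by (rule Q0)
    then have \<epsilon>: "\<epsilon> k > 0" using W_nonneg[of Q0 "P k"] by linarith
    show "\<forall>\<^sub>F r in at_right 0. r < \<epsilon> k"
      using \<epsilon> by (rule order_tendstoD(2)[OF tendsto_ident_at])
    have "((\<lambda>r. (\<epsilon> k - r) powr p - ((1 - t) * (\<epsilon> k + r) powr p + t * W Q0 (P k) powr p)) \<longlongrightarrow>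
        (\<epsilon> k - 0) powr p - ((1 - t) * (\<epsilon> k + 0) powr p + t * W Q0 (P k) powr p)) (at_right 0)"
      using \<epsilon> by (intro tendsto_intros) auto
    moreover have "0 < (\<epsilon> k - 0) powr p - ((1 - t) * (\<epsilon> k + 0) powr p + t * W Q0 (P k) powr p)"
      using powr_less_mono2[of p "W Q0 (P k)" "\<epsilon> k"] w p_ge_1 t by (simp add: algebra_simps)
    ultimately have "\<forall>\<^sub>F r in at_right 0.
        0 < (\<epsilon> k - r) powr p - ((1 - t) * (\<epsilon> k + r) powr p + t * W Q0 (P k) powr p)"
      by (rule order_tendstoD(1))
    then show "\<forall>\<^sub>F r in at_right 0. (1 - t) * (\<epsilon> k + r) powr p + t * W Q0 (P k) powr p < (\<epsilon> k - r) powr p"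
      by eventually_elim simp
  qed
  then have "\<forall>\<^sub>F r in at_right 0. 0 < r \<and> (\<forall>k\<in>I. r < \<epsilon> k \<and>
      (1 - t) * (\<epsilon> k + r) powr p + t * W Q0 (P k) powr p < (\<epsilon> k - r) powr p)"
    using eventually_at_right_less[of "0::real"] by eventually_elim auto
  then obtain r where r: "r > 0" "\<And>k. k \<in> I \<Longrightarrow> r < \<epsilon> k"
      "\<And>k. k \<in> I \<Longrightarrow> (1 - t) * (\<epsilon> k + r) powr p + t * W Q0 (P k) powr p < (\<epsilon> k - r) powr p"
    using eventually_happens[of _ "at_right (0::real)"] trivial_limit_at_right_real by blast
  have "W (mix t Q Q0) (P k) \<le> \<epsilon> k - r" if "Q \<in> \<W>" "k \<in> I" "W Q (P k) \<le> \<epsilon> k + r" for Q k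
  proof -
    have "W (mix t Q Q0) (P k) powr p \<le> (1 - t) * W Q (P k) powr p + t * W Q0 (P k) powr p"
      using that Q0 I t by (intro W_mix_le) auto
    also have "\<dots> \<le> (1 - t) * (\<epsilon> k + r) powr p + t * W Q0 (P k) powr p"
      using that t p_ge_1 by (intro add_right_mono mult_left_mono powr_mono2) auto
    also have "\<dots> < (\<epsilon> k - r) powr p" using r that by simp
    finally show ?thesis
      using r(2)[OF that(2)] p_ge_1 powr_less_mono2[of p "\<epsilon> k - r" "W (mix t Q Q0) (P k)"] by force
  qed
  with r(1) that show thesis by blast
qed

section \<open>Dependence of the worst-case risk on the centres and on the parameter\<close>

lemma worst_case_risk_stable:
  fixes l :: "'t \<Rightarrow> 'a \<Rightarrow> real"
  assumes K: "K \<ge> 1" and P: "\<And>k. k \<in> {1..K} \<Longrightarrow> P k \<in> \<W>"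
    and Q0: "Q0 \<in> \<W>" "\<And>k. k \<in> {1..K} \<Longrightarrow> W Q0 (P k) < \<epsilon> k"
    and B: "\<And>\<theta> x. \<theta> \<in> \<Theta> \<Longrightarrow> x \<in> M \<Longrightarrow> \<bar>l \<theta> x\<bar> \<le> B"
    and \<eta>: "\<eta> > 0"
  obtains r where "r > 0"
    "\<And>P' \<theta>. (\<And>k. k \<in> {1..K} \<Longrightarrow> P' k \<in> \<W> \<and> W (P k) (P' k) < r) \<Longrightarrow> \<theta> \<in> \<Theta> \<Longrightarrow>
      worst_case_risk (ball_intersection M d p K \<epsilon> P) l \<theta>
        \<le> worst_case_risk (ball_intersection M d p K \<epsilon> P') l \<theta> + ereal \<eta> \<and>
      worst_case_risk (ball_intersection M d p K \<epsilon> P') l \<theta>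
        \<le> worst_case_risk (ball_intersection M d p K \<epsilon> P) l \<theta> + ereal \<eta>"
proof -
  let ?BI = "ball_intersection M d p K \<epsilon>"
  \<comment> \<open>\<open>K \<ge> 1\<close> matters: an intersection over no balls would be the
    universal set instead of \<open>\<W>\<close>.\<close>
  have BI: "Q \<in> ?BI P' \<longleftrightarrow> Q \<in> \<W> \<and> (\<forall>k\<in>{1..K}. W Q (P' k) \<le> \<epsilon> k)" for Q P'
    using K by (auto simp: ball_intersection_def wasserstein_ball_def)
  define B' where "B' = \<bar>B\<bar> + 1"
  have B': "B' > 0" "\<And>\<theta> x. \<theta> \<in> \<Theta> \<Longrightarrow> x \<in> M \<Longrightarrow> \<bar>l \<theta> x\<bar> \<le> B'"
    unfolding B'_def using B by fastforce+
  \<comment> \<open>Mixing changes an integral by at most \<open>2 * t * B'\<close>, which this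
    choice keeps within \<open>\<eta>\<close>. Only the common bound on \<open>l\<close> enters, so
    \<open>t\<close> and then \<open>r\<close> serve every \<open>\<theta>\<close>.
    \<open>B'\<close> was enlarged to make the divisor positive.\<close>
  define t where "t = min 1 (\<eta> / (2 * B'))"
  have t: "0 < t" "t \<le> 1" "2 * t * B' \<le> \<eta>"
    using \<eta> B' by (auto simp: t_def min_def field_simps)
  obtain r where r: "r > 0"
    "\<And>Q k. Q \<in> \<W> \<Longrightarrow> k \<in> {1..K} \<Longrightarrow> W Q (P k) \<le> \<epsilon> k + r \<Longrightarrow> W (mix t Q Q0) (P k) \<le> \<epsilon> k - r"
    by (rule mix_slater_contracts[of "{1..K}" P Q0 \<epsilon> t]) (use P Q0 t in auto)
  have le: "worst_case_risk (?BI P1) l \<theta> \<le> worst_case_risk (?BI P2) l \<theta> + ereal \<eta>"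
    if \<theta>: "\<theta> \<in> \<Theta>" and sub: "\<And>Q. Q \<in> ?BI P1 \<Longrightarrow> mix t Q Q0 \<in> ?BI P2" for P1 P2 \<theta>
    unfolding worst_case_risk_def
  proof (rule SUP_least)
    fix Q assume Q: "Q \<in> ?BI P1"
    then have "\<bar>(\<integral> x. l \<theta> x \<partial>mix t Q Q0) - (\<integral> x. l \<theta> x \<partial>Q)\<bar> \<le> 2 * t * B'"
      using BI Q0 t B'(2)[OF \<theta>] by (intro integral_mix_close) auto
    then have "(\<integral> x. l \<theta> x \<partial>Q) \<le> (\<integral> x. l \<theta> x \<partial>mix t Q Q0) + \<eta>" using t(3) by linarith
    then have "ereal (\<integral> x. l \<theta> x \<partial>Q) \<le> ereal (\<integral> x. l \<theta> x \<partial>mix t Q Q0) + ereal \<eta>" by simp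
    also have "\<dots> \<le> (SUP Q\<in>?BI P2. ereal (\<integral> x. l \<theta> x \<partial>Q)) + ereal \<eta>"
      by (intro add_right_mono SUP_upper sub Q)
    finally show "ereal (\<integral> x. l \<theta> x \<partial>Q) \<le> (SUP Q\<in>?BI P2. ereal (\<integral> x. l \<theta> x \<partial>Q)) + ereal \<eta>" .
  qed
  show thesis
  proof (rule that[OF r(1)])
    fix P' \<theta> assume P': "\<And>k. k \<in> {1..K} \<Longrightarrow> P' k \<in> \<W> \<and> W (P k) (P' k) < r" and \<theta>: "\<theta> \<in> \<Theta>"
    \<comment> \<open>Here the target centre is shifted, which uses the slack in
      \<open>\<epsilon> k - r\<close>. In the converse direction the source centre is shifted, which
      uses the slack in \<open>\<epsilon> k + r\<close>; the same \<open>Q0\<close> serves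
      both.\<close>
    have "mix t Q Q0 \<in> ?BI P'" if "Q \<in> ?BI P" for Q
    proof -
      have Q: "Q \<in> \<W>" "\<And>k. k \<in> {1..K} \<Longrightarrow> W Q (P k) \<le> \<epsilon> k" using that BI by auto
      have mW: "mix t Q Q0 \<in> \<W>" using Q Q0 t by (intro mix_in_W) auto
      have "W (mix t Q Q0) (P' k) \<le> \<epsilon> k" if k: "k \<in> {1..K}" for k
        using r(2)[OF Q(1) k] Q(2)[OF k] r(1) W_triangle[OF mW P[OF k], of "P' k"] P'[OF k] by auto
      then show ?thesis using mW BI by auto
    qed
    moreover have "mix t Q Q0 \<in> ?BI P" if "Q \<in> ?BI P'" for Q
    proof -
      have Q: "Q \<in> \<W>" "\<And>k. k \<in> {1..K} \<Longrightarrow> W Q (P' k) \<le> \<epsilon> k" using that BI by auto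
      have mW: "mix t Q Q0 \<in> \<W>" using Q Q0 t by (intro mix_in_W) auto
      have "W (mix t Q Q0) (P k) \<le> \<epsilon> k" if k: "k \<in> {1..K}" for k
      proof -
        have "W Q (P k) \<le> \<epsilon> k + r"
          using W_triangle[OF Q(1) _ P[OF k], of "P' k"] P'[OF k] Q(2)[OF k] W_commute[of "P' k" "P k"] by auto
        then show ?thesis using r(2)[OF Q(1) k] r(1) by auto
      qed
      then show ?thesis using mW BI by auto
    qed
    ultimately show "worst_case_risk (?BI P) l \<theta> \<le> worst_case_risk (?BI P') l \<theta> + ereal \<eta> \<and>
      worst_case_risk (?BI P') l \<theta> \<le> worst_case_risk (?BI P) l \<theta> + ereal \<eta>"
      using le[OF \<theta>] by blast
  qed
qed

text \<open>Allows the extended-real risk to be handled as a real number. An integrand that is not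
  integrable contributes 0, which also obeys the bound.\<close>

lemma worst_case_risk_finite:
  fixes l :: "'t \<Rightarrow> 'a \<Rightarrow> real"
  assumes Q: "\<Q> \<noteq> {}" "\<Q> \<subseteq> \<W>" and B: "\<And>x. x \<in> M \<Longrightarrow> \<bar>l \<theta> x\<bar> \<le> B"
  shows "\<bar>worst_case_risk \<Q> l \<theta>\<bar> \<noteq> \<infinity>"
proof -
  have *: "\<bar>\<integral> x. l \<theta> x \<partial>Q\<bar> \<le> \<bar>B\<bar>" if "Q \<in> \<Q>" for Q
  proof -
    have W: "Q \<in> \<W>" using that Q by auto
    interpret prob_space Q using wasserstein_spaceD[OF W] by simp
    show ?thesis
    proof (cases "integrable Q (l \<theta>)")
      case True
      then have "(\<integral> x. \<bar>l \<theta> x\<bar> \<partial>Q) \<le> \<bar>B\<bar>"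
        using B wasserstein_spaceD(3)[OF W] by (intro integral_le_const) (auto intro!: AE_I2 order_trans[OF B])
      then show ?thesis using integral_abs_bound[of Q "l \<theta>"] by linarith
    qed (simp add: not_integrable_integral_eq)
  qed
  obtain Q where "Q \<in> \<Q>" using Q by auto
  then have "ereal (- \<bar>B\<bar>) \<le> worst_case_risk \<Q> l \<theta>"
    unfolding worst_case_risk_def using *[of Q] by (intro SUP_upper2[of Q]) auto
  moreover have "worst_case_risk \<Q> l \<theta> \<le> ereal \<bar>B\<bar>"
    unfolding worst_case_risk_def using * by (intro SUP_least) (simp add: abs_le_iff)
  ultimately show ?thesis by (cases "worst_case_risk \<Q> l \<theta>") auto
qed

text \<open>Both integrands have to be measurable: if just one of them had the default integral 0, a
  pointwise bound would say nothing about the integrals.\<close>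

lemma worst_case_risk_le_add:
  fixes l :: "'t \<Rightarrow> 'a \<Rightarrow> real"
  assumes \<Q>: "\<Q> \<subseteq> \<W>" and m: "l \<theta> \<in> borel_measurable N" "l \<theta>' \<in> borel_measurable N"
    and B: "\<And>x. x \<in> M \<Longrightarrow> \<bar>l \<theta> x\<bar> \<le> B" "\<And>x. x \<in> M \<Longrightarrow> \<bar>l \<theta>' x\<bar> \<le> B"
    and e: "\<And>x. x \<in> M \<Longrightarrow> l \<theta> x \<le> l \<theta>' x + e"
  shows "worst_case_risk \<Q> l \<theta> \<le> worst_case_risk \<Q> l \<theta>' + ereal e"
  unfolding worst_case_risk_def
proof (rule SUP_least)
  fix Q assume Q: "Q \<in> \<Q>"
  then have W: "Q \<in> \<W>" using \<Q> by auto
  interpret prob_space Q using wasserstein_spaceD[OF W] by simp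
  have "l \<theta> \<in> borel_measurable Q" "l \<theta>' \<in> borel_measurable Q"
    using m wasserstein_spaceD(2)[OF W] measurable_cong_sets by blast+
  then have int: "integrable Q (l \<theta>)" "integrable Q (l \<theta>')"
    using B wasserstein_spaceD(3)[OF W] by (auto intro!: integrable_const_bound[of _ B])
  then have "(\<integral> x. l \<theta> x \<partial>Q) \<le> (\<integral> x. l \<theta>' x + e \<partial>Q)"
    using e wasserstein_spaceD(3)[OF W] by (intro integral_mono) auto
  also have "\<dots> = (\<integral> x. l \<theta>' x \<partial>Q) + e" using int by (simp add: prob_space)
  finally have "ereal (\<integral> x. l \<theta> x \<partial>Q) \<le> ereal (\<integral> x. l \<theta>' x \<partial>Q) + ereal e" by simp
  also have "\<dots> \<le> (SUP Q\<in>\<Q>. ereal (\<integral> x. l \<theta>' x \<partial>Q)) + ereal e"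
    by (intro add_right_mono SUP_upper Q)
  finally show "ereal (\<integral> x. l \<theta> x \<partial>Q) \<le> (SUP Q\<in>\<Q>. ereal (\<integral> x. l \<theta>' x \<partial>Q)) + ereal e" .
qed

text \<open>The topology of \<open>d\<close> is unrelated to the one in which \<open>l\<close> is continuous, so \<open>l \<theta>\<close> may fail to
  be Borel measurable; then all its Bochner integrals are the junk value 0. The measurable
  parameters form a compact set, and on the remaining ones the risk is constant.\<close>

lemma worst_case_risk_gap:
  fixes l :: "'t::metric_space \<Rightarrow> 'a \<Rightarrow> real"
  assumes A: "compact A" and \<Q>: "\<Q> \<noteq> {}" "\<Q> \<subseteq> \<W>"
    and B: "\<And>\<theta> x. \<theta> \<in> A \<Longrightarrow> x \<in> M \<Longrightarrow> \<bar>l \<theta> x\<bar> \<le> B"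
    and l: "\<And>\<theta> e. \<theta> \<in> A \<Longrightarrow> e > 0 \<Longrightarrow>
        \<exists>\<delta>>0. \<forall>\<theta>'\<in>A. dist \<theta>' \<theta> < \<delta> \<longrightarrow> (\<forall>x\<in>M. \<bar>l \<theta>' x - l \<theta> x\<bar> < e)"
    and v: "\<And>\<theta>. \<theta> \<in> A \<Longrightarrow> ereal v < worst_case_risk \<Q> l \<theta>"
  obtains \<gamma> where "\<gamma> > 0" "\<And>\<theta>. \<theta> \<in> A \<Longrightarrow> ereal (v + \<gamma>) \<le> worst_case_risk \<Q> l \<theta>"
proof -
  define f where "f \<theta> = real_of_ereal (worst_case_risk \<Q> l \<theta>)" for \<theta>
  have f: "worst_case_risk \<Q> l \<theta> = ereal (f \<theta>)" if "\<theta> \<in> A" for \<theta>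
    using worst_case_risk_finite[OF \<Q>, of l \<theta> B] B[OF that] by (simp add: f_def ereal_real')
  define T where "T = {\<theta>\<in>A. l \<theta> \<in> borel_measurable N}"
  \<comment> \<open>Nearby parameters give uniformly close functions, and pointwise limits of
    measurable functions are measurable.\<close>
  have "closed T"
    unfolding closed_sequential_limits
  proof (intro allI impI)
    fix X \<theta> assume X: "(\<forall>n. X n \<in> T) \<and> X \<longlonglongrightarrow> \<theta>"
    have \<theta>: "\<theta> \<in> A"
      using X compact_imp_closed[OF A] unfolding closed_sequential_limits T_def by blast
    have "l \<theta> \<in> borel_measurable N"
    proof (rule borel_measurable_LIMSEQ_real)
      show "l (X n) \<in> borel_measurable N" for n using X by (simp add: T_def)
      fix x assume "x \<in> space N"
      then have x: "x \<in> M" by simp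
      show "(\<lambda>n. l (X n) x) \<longlonglongrightarrow> l \<theta> x"
      proof (rule tendstoI)
        fix e :: real assume "e > 0"
        then obtain \<delta> where \<delta>: "\<delta> > 0" "\<forall>\<theta>'\<in>A. dist \<theta>' \<theta> < \<delta> \<longrightarrow> (\<forall>x\<in>M. \<bar>l \<theta>' x - l \<theta> x\<bar> < e)"
          using l[OF \<theta>] by blast
        have "\<forall>\<^sub>F n in sequentially. dist (X n) \<theta> < \<delta>" using X \<delta>(1) by (auto dest: tendstoD)
        then show "\<forall>\<^sub>F n in sequentially. dist (l (X n) x) (l \<theta> x) < e"
          by eventually_elim (use X \<delta>(2) x in \<open>auto simp: T_def dist_real_def\<close>)
      qed
    qed
    then show "\<theta> \<in> T" using \<theta> by (simp add: T_def)
  qed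
  moreover have "A \<inter> T = T" by (auto simp: T_def)
  ultimately have "compact T" using compact_Int_closed[OF A, of T] by simp
  have "continuous_on T f"
    unfolding continuous_on_iff
  proof (intro ballI allI impI)
    fix \<theta> and e :: real assume \<theta>: "\<theta> \<in> T" and "e > 0"
    then have "\<theta> \<in> A" "e / 2 > 0" by (auto simp: T_def)
    from l[OF this] obtain \<delta> where \<delta>: "\<delta> > 0"
        "\<forall>\<theta>'\<in>A. dist \<theta>' \<theta> < \<delta> \<longrightarrow> (\<forall>x\<in>M. \<bar>l \<theta>' x - l \<theta> x\<bar> < e / 2)"
      by blast
    have "dist (f \<theta>') (f \<theta>) < e" if \<theta>': "\<theta>' \<in> T" "dist \<theta>' \<theta> < \<delta>" for \<theta>'
    proof -
      have A: "\<theta> \<in> A" "\<theta>' \<in> A" and m: "l \<theta> \<in> borel_measurable N" "l \<theta>' \<in> borel_measurable N"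
        using \<theta> \<theta>' by (auto simp: T_def)
      have d: "\<bar>l \<theta>' x - l \<theta> x\<bar> < e / 2" if "x \<in> M" for x using \<delta>(2) A \<theta>' that by auto
      have "l \<theta> x \<le> l \<theta>' x + e / 2" "l \<theta>' x \<le> l \<theta> x + e / 2" if "x \<in> M" for x
        using d[OF that] by linarith+
      then have "worst_case_risk \<Q> l \<theta> \<le> worst_case_risk \<Q> l \<theta>' + ereal (e / 2)"
        "worst_case_risk \<Q> l \<theta>' \<le> worst_case_risk \<Q> l \<theta> + ereal (e / 2)"
        using B A m \<Q> by (auto intro!: worst_case_risk_le_add[where B=B])
      then have "f \<theta> \<le> f \<theta>' + e / 2" "f \<theta>' \<le> f \<theta> + e / 2"
        unfolding f[OF A(1)] f[OF A(2)] by simp_all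
      then show ?thesis using \<open>e > 0\<close> by (simp add: dist_real_def)
    qed
    then show "\<exists>\<delta>>0. \<forall>\<theta>'\<in>T. dist \<theta>' \<theta> < \<delta> \<longrightarrow> dist (f \<theta>') (f \<theta>) < e" using \<delta>(1) by blast
  qed
  have v': "v < f \<theta>" if "\<theta> \<in> A" for \<theta> using v[OF that] f[OF that] by simp
  have "\<exists>\<gamma>>0. \<forall>\<theta>\<in>T. v + \<gamma> \<le> f \<theta>"
  proof (cases "T = {}")
    case True
    then show ?thesis by (auto intro!: exI[of _ 1])
  next
    case False
    then obtain \<theta> where "\<theta> \<in> T" "\<forall>\<theta>'\<in>T. f \<theta> \<le> f \<theta>'"
      using continuous_attains_inf[OF \<open>compact T\<close> _ \<open>continuous_on T f\<close>] by blast
    then show ?thesis using v'[of \<theta>] by (intro exI[of _ "f \<theta> - v"]) (auto simp: T_def)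
  qed
  then obtain \<gamma>1 where \<gamma>1: "\<gamma>1 > 0" "\<And>\<theta>. \<theta> \<in> T \<Longrightarrow> v + \<gamma>1 \<le> f \<theta>" by blast
  have f0: "f \<theta> = 0" if "\<theta> \<in> A - T" for \<theta>
  proof -
    have "(\<integral> x. l \<theta> x \<partial>Q) = 0" if "Q \<in> \<Q>" for Q
    proof (rule not_integrable_integral_eq)
      have "sets Q = sets N" using that \<Q> wasserstein_spaceD by blast
      then show "\<not> integrable Q (l \<theta>)"
        using \<open>\<theta> \<in> A - T\<close> measurable_cong_sets[of Q N borel borel]
        by (auto simp: T_def dest: borel_measurable_integrable)
    qed
    then have "worst_case_risk \<Q> l \<theta> = 0" using \<Q>(1) by (simp add: worst_case_risk_def zero_ereal_def)
    then show ?thesis by (simp add: f_def)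
  qed
  \<comment> \<open>At a parameter outside \<open>T\<close> the risk is 0, so the assumed strict
    inequality reads \<open>v < 0\<close> and the gap there is \<open>- v\<close>.\<close>
  define \<gamma> where "\<gamma> = (if A - T = {} then \<gamma>1 else min \<gamma>1 (- v))"
  have "\<gamma> > 0" using \<gamma>1(1) v' f0 by (fastforce simp: \<gamma>_def)
  moreover have "ereal (v + \<gamma>) \<le> worst_case_risk \<Q> l \<theta>" if "\<theta> \<in> A" for \<theta>
    using \<gamma>1(2)[of \<theta>] f0[of \<theta>] that by (cases "\<theta> \<in> T") (auto simp: f[OF that] \<gamma>_def)
  ultimately show thesis by (rule that)
qed

end

theorem corollary3:
  fixes \<Theta> :: "(real ^ 'n) set" and \<Xi> :: "(real ^ 'd) set"
    and \<rho> :: "real ^ 'd \<Rightarrow> real ^ 'd \<Rightarrow> real" and p :: real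
    and l :: "real ^ 'n \<Rightarrow> real ^ 'd \<Rightarrow> real"
    and K :: nat and \<epsilon> :: "nat \<Rightarrow> real"
    and \<theta>s :: "(nat \<Rightarrow> (real ^ 'd) measure) \<Rightarrow> real ^ 'n"
  assumes "\<Theta> \<noteq> {}" and "compact \<Theta>"
    and "\<Xi> \<noteq> {}" and "compact \<Xi>" and "convex \<Xi>"
    and "Metric_space \<Xi> \<rho>"
    and "Metric_space.mcomplete \<Xi> \<rho>"
    and "separable_space (Metric_space.mtopology \<Xi> \<rho>)"
    and "geodesic_space \<Xi> \<rho>"
    and "p \<ge> 1"
    and "continuous_on (\<Theta> \<times> \<Xi>) (\<lambda>(\<theta>, \<xi>). l \<theta> \<xi>)"
    and "K \<ge> 1"
    and "\<And>k. k \<in> {1..K} \<Longrightarrow> \<epsilon> k > 0"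
    and "\<And>P. P \<in> interior_centers \<Xi> \<rho> p K \<epsilon> \<Longrightarrow>
           {\<theta>. is_arg_min (worst_case_risk (ball_intersection \<Xi> \<rho> p K \<epsilon> P) l) (\<lambda>\<theta>. \<theta> \<in> \<Theta>) \<theta>}
             = {\<theta>s P}"
  shows "continuous_map
           (subtopology (product_topology (\<lambda>_. wasserstein_topology \<Xi> \<rho> p) {1..K})
              (interior_centers \<Xi> \<rho> p K \<epsilon>))
           (top_of_set \<Theta>) \<theta>s"
proof -
  interpret wasserstein_metric \<Xi> \<rho> p
    using assms by (simp add: wasserstein_metric_def wasserstein_metric_axioms_def)
  let ?U = "interior_centers \<Xi> \<rho> p K \<epsilon>"
  let ?R = "\<lambda>P. worst_case_risk (ball_intersection \<Xi> \<rho> p K \<epsilon> P) l"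
  let ?X = "product_topology (\<lambda>_. W.mtopology) {1..K}"
  have top: "wasserstein_topology \<Xi> \<rho> p = W.mtopology" by (simp add: wasserstein_topology_def)
  have cpt: "compact (\<Theta> \<times> \<Xi>)" using assms(2,4) by (rule compact_Times)
  obtain B where "\<forall>y\<in>(\<lambda>(\<theta>, \<xi>). l \<theta> \<xi>) ` (\<Theta> \<times> \<Xi>). norm y \<le> B"
    using compact_imp_bounded[OF compact_continuous_image[OF assms(11) cpt]] unfolding bounded_iff by blast
  then have B: "\<bar>l \<theta> x\<bar> \<le> B" if "\<theta> \<in> \<Theta>" "x \<in> \<Xi>" for \<theta> x using that by force
  \<comment> \<open>Uniform continuity on the compact product, in the Euclidean metric: one
    \<open>\<delta>\<close> serves all \<open>x\<close> simultaneously.\<close>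
  have equi: "\<exists>\<delta>>0. \<forall>\<theta>'\<in>\<Theta>. dist \<theta>' \<theta> < \<delta> \<longrightarrow> (\<forall>x\<in>\<Xi>. \<bar>l \<theta>' x - l \<theta> x\<bar> < e)"
    if \<theta>: "\<theta> \<in> \<Theta>" and e: "e > 0" for \<theta> e
  proof -
    obtain \<delta> where \<delta>: "\<delta> > 0" "\<And>z z'. z \<in> \<Theta> \<times> \<Xi> \<Longrightarrow> z' \<in> \<Theta> \<times> \<Xi> \<Longrightarrow> dist z' z < \<delta> \<Longrightarrow>
        dist (case z' of (\<theta>, \<xi>) \<Rightarrow> l \<theta> \<xi>) (case z of (\<theta>, \<xi>) \<Rightarrow> l \<theta> \<xi>) < e"
      using compact_uniformly_continuous[OF assms(11) cpt] e unfolding uniformly_continuous_on_def by metis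
    have "\<bar>l \<theta>' x - l \<theta> x\<bar> < e" if "\<theta>' \<in> \<Theta>" "dist \<theta>' \<theta> < \<delta>" "x \<in> \<Xi>" for \<theta>' x
      using \<delta>(2)[of "(\<theta>, x)" "(\<theta>', x)"] that \<theta> by (simp add: dist_Pair_Pair dist_real_def)
    with \<delta>(1) show ?thesis by blast
  qed
  have U_W: "P \<in> {1..K} \<rightarrow>\<^sub>E \<W>" if "P \<in> ?U" for P using that by (simp add: interior_centers_def)
  have \<theta>s: "\<theta>s P \<in> \<Theta>" "\<And>\<theta>. \<theta> \<in> \<Theta> \<Longrightarrow> ?R P (\<theta>s P) \<le> ?R P \<theta>"
    "\<And>\<theta>. \<theta> \<in> \<Theta> \<Longrightarrow> \<theta> \<noteq> \<theta>s P \<Longrightarrow> ?R P (\<theta>s P) < ?R P \<theta>" if P: "P \<in> ?U" for P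
  proof -
    have "is_arg_min (?R P) (\<lambda>\<theta>. \<theta> \<in> \<Theta>) (\<theta>s P)" using assms(14)[OF P] by blast
    then show 1: "\<theta>s P \<in> \<Theta>" and 2: "\<And>\<theta>. \<theta> \<in> \<Theta> \<Longrightarrow> ?R P (\<theta>s P) \<le> ?R P \<theta>"
      by (auto simp: is_arg_min_def not_less)
    fix \<theta> assume \<theta>: "\<theta> \<in> \<Theta>" "\<theta> \<noteq> \<theta>s P"
    \<comment> \<open>Uniqueness enters here: any other point fails to be a minimiser, so some
      feasible point beats it strictly.\<close>
    have "\<not> is_arg_min (?R P) (\<lambda>\<theta>. \<theta> \<in> \<Theta>) \<theta>" using assms(14)[OF P] \<theta>(2) by blast
    then obtain y where "y \<in> \<Theta>" "?R P y < ?R P \<theta>" using \<theta>(1) by (auto simp: is_arg_min_def)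
    then show "?R P (\<theta>s P) < ?R P \<theta>" using 2 by (meson le_less_trans)
  qed
  have local: "\<exists>S. openin (subtopology ?X ?U) S \<and> P \<in> S \<and> S \<subseteq> {P \<in> ?U. \<theta>s P \<in> V}"
    if P: "P \<in> ?U" and V: "open V" "\<theta>s P \<in> V" for P V
  proof -
    have PW: "P k \<in> \<W>" if "k \<in> {1..K}" for k using U_W[OF P] that by auto
    let ?BI = "ball_intersection \<Xi> \<rho> p K \<epsilon> P"
    have BI: "Q \<in> ?BI \<longleftrightarrow> Q \<in> \<W> \<and> (\<forall>k\<in>{1..K}. W Q (P k) \<le> \<epsilon> k)" for Q
      using assms(12) by (auto simp: ball_intersection_def wasserstein_ball_def)
    define G where "G = W.mtopology interior_of ?BI"
    have G: "openin W.mtopology G" "G \<noteq> {}" "G \<subseteq> ?BI"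
      using P by (auto simp: G_def interior_centers_def top interior_of_subset)
    obtain Q0 where Q0: "Q0 \<in> \<W>" "\<And>k. k \<in> {1..K} \<Longrightarrow> W Q0 (P k) < \<epsilon> k"
      by (rule slater_point[of "{1..K}" P \<epsilon> G]) (use PW assms(13) G BI in auto)
    then have ne: "?BI \<noteq> {}" "?BI \<subseteq> \<W>" using BI by force+
    define v where "v = real_of_ereal (?R P (\<theta>s P))"
    have v: "?R P (\<theta>s P) = ereal v"
      using worst_case_risk_finite[OF ne, of l "\<theta>s P" B] B[OF \<theta>s(1)[OF P]] by (simp add: v_def ereal_real')
    have v_less: "ereal v < ?R P \<theta>" if "\<theta> \<in> \<Theta> - V" for \<theta>
      using \<theta>s(3)[OF P, of \<theta>] that V v by auto
    have B': "\<bar>l \<theta> x\<bar> \<le> B" if "\<theta> \<in> \<Theta> - V" "x \<in> \<Xi>" for \<theta> x using B that by auto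
    have equi': "\<exists>\<delta>>0. \<forall>\<theta>'\<in>\<Theta> - V. dist \<theta>' \<theta> < \<delta> \<longrightarrow> (\<forall>x\<in>\<Xi>. \<bar>l \<theta>' x - l \<theta> x\<bar> < e)"
      if "\<theta> \<in> \<Theta> - V" "e > 0" for \<theta> e
      using equi[of \<theta> e] that by (meson Diff_iff)
    \<comment> \<open>\<open>V\<close> is a neighbourhood of the minimiser for \<open>P\<close>, so
      outside it the risk is strictly larger; compactness of \<open>\<Theta> - V\<close> makes the
      gap uniform.\<close>
    obtain \<gamma> where \<gamma>: "\<gamma> > 0" "\<And>\<theta>. \<theta> \<in> \<Theta> - V \<Longrightarrow> ereal (v + \<gamma>) \<le> ?R P \<theta>"
      by (rule worst_case_risk_gap[OF compact_diff[OF assms(2) V(1)] ne B' equi' v_less]) blast+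
    \<comment> \<open>The contradiction below passes twice between the risks for \<open>P\<close>
      and for \<open>P'\<close>, each time at cost \<open>\<eta>\<close>, and
      \<open>2 * \<eta> < \<gamma>\<close>.\<close>
    define \<eta> where "\<eta> = \<gamma> / 3"
    have \<eta>: "\<eta> > 0" using \<gamma>(1) by (simp add: \<eta>_def)
    obtain r where r: "r > 0"
      "\<And>P' \<theta>. (\<And>k. k \<in> {1..K} \<Longrightarrow> P' k \<in> \<W> \<and> W (P k) (P' k) < r) \<Longrightarrow> \<theta> \<in> \<Theta> \<Longrightarrow>
        ?R P \<theta> \<le> ?R P' \<theta> + ereal \<eta> \<and> ?R P' \<theta> \<le> ?R P \<theta> + ereal \<eta>"
      by (rule worst_case_risk_stable[OF assms(12) PW Q0 B \<eta>]) blast+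
    \<comment> \<open>A box of open balls is open in the product topology because there are finitely
      many coordinates.\<close>
    define S where "S = (\<Pi>\<^sub>E k\<in>{1..K}. W.mball (P k) r) \<inter> ?U"
    have "openin ?X (\<Pi>\<^sub>E k\<in>{1..K}. W.mball (P k) r)"
      by (subst openin_PiE) auto
    then have "openin (subtopology ?X ?U) S"
      unfolding S_def by (rule openin_subtopology_Int)
    moreover have "P \<in> S"
      using P U_W[OF P] PW r(1) by (auto simp: S_def PiE_iff W.in_mball)
    moreover have "\<theta>s P' \<in> V" if P': "P' \<in> S" for P'
    proof (rule ccontr)
      have P'U: "P' \<in> ?U" using P' by (simp add: S_def)
      have near: "P' k \<in> \<W> \<and> W (P k) (P' k) < r" if "k \<in> {1..K}" for k
        using P' that by (auto simp: S_def PiE_iff W.in_mball)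
      assume "\<theta>s P' \<notin> V"
      then have \<theta>': "\<theta>s P' \<in> \<Theta>" "\<theta>s P' \<in> \<Theta> - V" using \<theta>s(1)[OF P'U] by auto
      have "ereal (v + \<gamma>) \<le> ?R P (\<theta>s P')" by (rule \<gamma>(2)[OF \<theta>'(2)])
      also have "\<dots> \<le> ?R P' (\<theta>s P') + ereal \<eta>" using r(2)[OF near \<theta>'(1)] by blast
      also have "\<dots> \<le> ?R P' (\<theta>s P) + ereal \<eta>"
        by (intro add_right_mono \<theta>s(2)[OF P'U \<theta>s(1)[OF P]])
      also have "\<dots> \<le> (?R P (\<theta>s P) + ereal \<eta>) + ereal \<eta>"
        using r(2)[OF near \<theta>s(1)[OF P]] by (intro add_right_mono) blast
      also have "\<dots> = ereal (v + 2 * \<eta>)" by (simp add: v)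
      finally show False using \<gamma>(1) by (simp add: \<eta>_def)
    qed
    ultimately show ?thesis by (intro exI[of _ S]) (auto simp: S_def)
  qed
  have topU: "topspace (subtopology ?X ?U) = ?U"
    using U_W by (auto simp: topspace_product_topology)
  show ?thesis
    unfolding top continuous_map_def topU
  proof (intro conjI allI impI)
    show "\<theta>s \<in> ?U \<rightarrow> topspace (top_of_set \<Theta>)" using \<theta>s(1) by auto
    fix V' assume "openin (top_of_set \<Theta>) V'"
    then obtain V where V: "open V" "V' = \<Theta> \<inter> V" by (auto simp: openin_open)
    have "{P \<in> ?U. \<theta>s P \<in> V'} = {P \<in> ?U. \<theta>s P \<in> V}" using \<theta>s(1) V(2) by auto
    then show "openin (subtopology ?X ?U) {P \<in> ?U. \<theta>s P \<in> V'}"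
      using local V(1) by (subst openin_subopen) auto
  qed
qed

end
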